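(* Let $T>0$, $I:=(0,T)$, $K\in L^2(I^2;\mathbb{C})$ and let $C_K$ be such that, for all $u,v\in L^2((0,T);\mathbb{C})$, $$\left|\int_{I^2}K(s,t)u(s)\overline{v}(t)\,\mathrm{d}s\,\mathrm{d}t\right|\leq C_K\|u\|_{L^2}\|v\|_{L^2}.$$ Let $\chi\in W^{1,\infty}(I^2;\mathbb{C})$ vanish on the diagonal $\{s=t\}$. Then, for all $u,v\in L^2((0,T);\mathbb{C})$, $$\left|\int_{I^2}\chi(s,t)K(s,t)u(s)\overline{v}(t)\,\mathrm{d}s\,\mathrm{d}t\right|\leq TC_K\left(\|\partial_1\chi\|_{L^\infty}+\|\partial_2\chi\|_{L^\infty}\right)\|u\|_{L^2}\|v\|_{L^2}.$$
   Context: $\partial_1$ and $\partial_2$ denote the partial derivatives with respect to the first variable $s$ and the second variable $t$. Functions in $W^{1,\infty}(I^2)$ are identified with their continuous representatives, so vanishing on the diagonal makes sense. *)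

theory Defs
  imports "HOL-Probability.Essential_Supremum"
begin

text \<open>Elements of the spaces below are functions, not classes modulo null sets; only their
  values on the underlying set matter.\<close>

definition L2 :: "'a::euclidean_space set \<Rightarrow> ('a \<Rightarrow> complex) set" where
  "L2 S = {f \<in> borel_measurable (lebesgue_on S). integrable (lebesgue_on S) (\<lambda>x. (cmod (f x))\<^sup>2)}"

definition L2_norm :: "'a::euclidean_space set \<Rightarrow> ('a \<Rightarrow> complex) \<Rightarrow> real" where
  "L2_norm S f = sqrt (\<integral>x. (cmod (f x))\<^sup>2 \<partial>lebesgue_on S)"

definition Linf :: "'a::euclidean_space set \<Rightarrow> ('a \<Rightarrow> complex) set" where
  "Linf S = {f \<in> borel_measurable (lebesgue_on S).
     esssup (lebesgue_on S) (\<lambda>x. ereal (cmod (f x))) < \<infinity>}"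

definition Linf_norm :: "'a::euclidean_space set \<Rightarrow> ('a \<Rightarrow> complex) \<Rightarrow> real" where
  "Linf_norm S f = real_of_ereal (esssup (lebesgue_on S) (\<lambda>x. ereal (cmod (f x))))"

text \<open>\<open>times_differentiable k f\<close>: all iterated partial derivatives of order less than \<open>k\<close> exist
  and are (Frechet) differentiable, and those of order \<open>k\<close> are continuous. Quantifying over
  all \<open>k\<close> gives the smooth functions.\<close>

primrec times_differentiable :: "nat \<Rightarrow> ('a::euclidean_space \<Rightarrow> real) \<Rightarrow> bool" where
  "times_differentiable 0 f \<longleftrightarrow> continuous_on UNIV f"
| "times_differentiable (Suc k) f \<longleftrightarrow> f differentiable_on UNIV \<and>
     (\<forall>b\<in>Basis. times_differentiable k (\<lambda>x. frechet_derivative f (at x) b))"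

definition test_function :: "'a::euclidean_space set \<Rightarrow> ('a \<Rightarrow> real) \<Rightarrow> bool" where
  "test_function S \<phi> \<longleftrightarrow> (\<forall>k. times_differentiable k \<phi>) \<and>
     compact (closure {x. \<phi> x \<noteq> 0}) \<and> closure {x. \<phi> x \<noteq> 0} \<subseteq> S"

definition locally_integrable_on :: "('a::euclidean_space \<Rightarrow> complex) \<Rightarrow> 'a set \<Rightarrow> bool" where
  "locally_integrable_on f S \<longleftrightarrow> (\<forall>C. compact C \<and> C \<subseteq> S \<longrightarrow> f absolutely_integrable_on C)"

text \<open>\<open>has_weak_partial S b f g\<close>: on the open set \<open>S\<close>, \<open>g\<close> is a weak derivative of \<open>f\<close> in the
  direction of the basis vector \<open>b\<close>. Real test functions suffice for complex \<open>f\<close>, since both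
  sides are linear in \<open>\<phi>\<close>.\<close>

definition has_weak_partial ::
  "'a::euclidean_space set \<Rightarrow> 'a \<Rightarrow> ('a \<Rightarrow> complex) \<Rightarrow> ('a \<Rightarrow> complex) \<Rightarrow> bool" where
  "has_weak_partial S b f g \<longleftrightarrow> locally_integrable_on f S \<and> locally_integrable_on g S \<and>
     (\<forall>\<phi>. test_function S \<phi> \<longrightarrow>
        (\<integral>x. f x * of_real (frechet_derivative \<phi> (at x) b) \<partial>lebesgue_on S)
          = - (\<integral>x. g x * of_real (\<phi> x) \<partial>lebesgue_on S))"

text \<open>A weak derivative is unique up to a null set, on which neither membership in \<open>Linf S\<close> nor
  \<open>Linf_norm S\<close> depends; so the choice below is immaterial.\<close>

definition weak_partial ::
  "'a::euclidean_space set \<Rightarrow> 'a \<Rightarrow> ('a \<Rightarrow> complex) \<Rightarrow> 'a \<Rightarrow> complex" where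
  "weak_partial S b f = (SOME g. has_weak_partial S b f g)"

definition W1inf :: "'a::euclidean_space set \<Rightarrow> ('a \<Rightarrow> complex) set" where
  "W1inf S = {f \<in> Linf S. \<forall>b\<in>Basis. (\<exists>g. has_weak_partial S b f g) \<and> weak_partial S b f \<in> Linf S}"

end

theory Submission
  imports Defs
begin

text \<open>Since \<open>\<chi>\<close> vanishes on the diagonal, \<open>\<chi>(s,t)\<close> is the integral of \<open>\<partial>\<^sub>1\<chi>(\<tau>,t)\<close> over \<open>t < \<tau> < s\<close>
  when \<open>t < s\<close>, and of \<open>\<partial>\<^sub>2\<chi>(s,\<tau>)\<close> over \<open>s < \<tau> < t\<close> when \<open>s < t\<close>. For fixed \<open>\<tau>\<close> the condition
  \<open>t < \<tau> < s\<close> factorises into a condition on \<open>s\<close> and one on \<open>t\<close>, so the hypothesis on \<open>K\<close> applies to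
  \<open>u\<close> and \<open>v\<close> multiplied by bounded functions, and integrating over \<open>\<tau>\<close> costs a factor \<open>T\<close>.
  To avoid differentiating Lipschitz functions, the integral over \<open>\<tau>\<close> is replaced by a telescoping
  sum over a uniform grid with \<open>N\<close> cells, up to an error \<open>O(1/N)\<close> in \<open>\<chi>\<close>; this needs only the
  Lipschitz bounds in each variable, which follow from testing the weak derivative against a smooth
  approximation of the uniform measure on a segment.\<close>

section \<open>Smooth step functions\<close>

lemma times_differentiable_SucI:
  assumes "\<And>x. (f has_derivative f' x) (at x)"
    and "\<And>b. b \<in> Basis \<Longrightarrow> times_differentiable k (\<lambda>x. f' x b)"
  shows "times_differentiable (Suc k) f"
proof -
  have "frechet_derivative f (at x) = f' x" for x
    using frechet_derivative_at[OF assms(1)] by simp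
  with assms show ?thesis
    by (auto simp: differentiable_on_def differentiable_def)
qed

lemma times_differentiable_SucD:
  assumes "times_differentiable (Suc k) f"
  shows "(f has_derivative frechet_derivative f (at x)) (at x)"
    and "b \<in> Basis \<Longrightarrow> times_differentiable k (\<lambda>x. frechet_derivative f (at x) b)"
  using assms by (auto simp: differentiable_on_def frechet_derivative_works)

lemma times_differentiable_Suc_imp:
  "times_differentiable (Suc k) f \<Longrightarrow> times_differentiable k f"
proof (induction k arbitrary: f)
  case 0
  then show ?case by (auto intro: differentiable_imp_continuous_on)
next
  case (Suc k)
  then have "f differentiable_on UNIV"
    and *: "\<And>b. b \<in> Basis \<Longrightarrow> times_differentiable (Suc k) (\<lambda>x. frechet_derivative f (at x) b)"
    by simp_all
  then show ?case using Suc.IH[OF *] by (simp only: times_differentiable.simps(2)) blast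
qed

lemma times_differentiable_const: "times_differentiable k (\<lambda>_. c)"
proof (induction k arbitrary: c)
  case (Suc k)
  show ?case by (rule times_differentiable_SucI[where f' = "\<lambda>_ _. 0"]) (auto intro: Suc)
qed simp

lemma times_differentiable_add:
  "times_differentiable k f \<Longrightarrow> times_differentiable k g \<Longrightarrow> times_differentiable k (\<lambda>x. f x + g x)"
proof (induction k arbitrary: f g)
  case (Suc k)
  note f = times_differentiable_SucD[OF Suc.prems(1)]
    and g = times_differentiable_SucD[OF Suc.prems(2)]
  show ?case
    by (rule times_differentiable_SucI[OF has_derivative_add[OF f(1) g(1)]])
       (intro Suc.IH f(2) g(2))
qed (simp add: continuous_on_add)

text \<open>Each term of the Leibniz rule keeps one factor undifferentiated, which is why
  \<open>times_differentiable_Suc_imp\<close> enters the induction step.\<close>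

lemma times_differentiable_mult:
  "times_differentiable k f \<Longrightarrow> times_differentiable k g \<Longrightarrow> times_differentiable k (\<lambda>x. f x * g x)"
proof (induction k arbitrary: f g)
  case (Suc k)
  note f = times_differentiable_SucD[OF Suc.prems(1)]
    and g = times_differentiable_SucD[OF Suc.prems(2)]
  show ?case
    by (rule times_differentiable_SucI[OF has_derivative_mult[OF f(1) g(1)]])
       (intro times_differentiable_add Suc.IH f(2) g(2) Suc.prems[THEN times_differentiable_Suc_imp])
qed (simp add: continuous_on_mult)

lemma times_differentiable_diff:
  assumes "times_differentiable k f" "times_differentiable k g"
  shows "times_differentiable k (\<lambda>x. f x - g x)"
  using times_differentiable_add[OF assms(1)
      times_differentiable_mult[OF times_differentiable_const[of k "-1"] assms(2)]]
  by simp

lemma times_differentiable_prod: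
  "finite A \<Longrightarrow> (\<And>i. i \<in> A \<Longrightarrow> times_differentiable k (f i)) \<Longrightarrow>
    times_differentiable k (\<lambda>x. \<Prod>i\<in>A. f i x)"
  by (induction A rule: finite_induct)
     (simp_all add: times_differentiable_mult times_differentiable_const)

text \<open>Affine inner maps suffice for the test functions below, which are products of
  one-variable functions of single coordinates. A partial derivative is again such a composition
  times a constant, so the induction closes.\<close>

lemma times_differentiable_compose_inner:
  fixes f :: "real \<Rightarrow> real" and c :: "'a::euclidean_space"
  shows "times_differentiable k f \<Longrightarrow> times_differentiable k (\<lambda>x. f (x \<bullet> c + d))"
proof (induction k arbitrary: f)
  case 0
  then have "continuous_on UNIV f" by simp
  moreover have "continuous_on UNIV (\<lambda>x. x \<bullet> c + d)" by (intro continuous_intros)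
  ultimately have "continuous_on UNIV (\<lambda>x. f (x \<bullet> c + d))"
    by (rule continuous_on_compose2) simp
  then show ?case by simp
next
  case (Suc k)
  note f = times_differentiable_SucD[OF Suc.prems]
  let ?D = "\<lambda>x. frechet_derivative f (at x)"
  have *: "((\<lambda>x. f (x \<bullet> c + d)) has_derivative (\<lambda>v. ?D (x \<bullet> c + d) 1 * (v \<bullet> c))) (at x)" for x
  proof -
    have "((\<lambda>x. x \<bullet> c + d) has_derivative (\<lambda>v. v \<bullet> c)) (at x)"
      by (auto intro!: derivative_eq_intros)
    from has_derivative_compose[OF this f(1)]
    have "((\<lambda>x. f (x \<bullet> c + d)) has_derivative (\<lambda>v. ?D (x \<bullet> c + d) (v \<bullet> c))) (at x)" .
    moreover have "(\<lambda>v. ?D (x \<bullet> c + d) (v \<bullet> c)) = (\<lambda>v. ?D (x \<bullet> c + d) 1 * (v \<bullet> c))"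
    proof
      show "?D (x \<bullet> c + d) (v \<bullet> c) = ?D (x \<bullet> c + d) 1 * (v \<bullet> c)" for v
        using linear_scale[OF has_derivative_linear[OF f(1)], of "x \<bullet> c + d" "v \<bullet> c" 1]
        by (simp add: mult.commute)
    qed
    ultimately show ?thesis by (rule has_derivative_eq_rhs)
  qed
  show ?case
  proof (rule times_differentiable_SucI[OF *])
    fix b :: 'a
    have "times_differentiable k (\<lambda>x. ?D x 1)" by (rule f(2)) simp
    from times_differentiable_mult[OF Suc.IH[OF this] times_differentiable_const]
    show "times_differentiable k (\<lambda>x. ?D (x \<bullet> c + d) 1 * (b \<bullet> c))" .
  qed
qed

text \<open>The classical function exp(-1/x), extended by 0, is \<open>flat 1\<close>. The
  polynomial in 1/x makes the family closed under differentiation, so one induction over all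
  \<open>p\<close> gives smoothness.\<close>

definition flat :: "real poly \<Rightarrow> real \<Rightarrow> real" where
  "flat p x = (if x \<le> 0 then 0 else poly p (1 / x) * exp (- 1 / x))"

text \<open>The power \<open>k\<close> is generalised because peeling off a coefficient of
  \<open>p\<close> moves one factor \<open>x\<close> out of the polynomial.\<close>

lemma poly_div_exp_tendsto_0: "((\<lambda>x. x ^ k * poly p x / exp x) \<longlongrightarrow> (0::real)) at_top"
proof (induction p arbitrary: k)
  case (pCons a p)
  have "((\<lambda>x. a * (x ^ k / exp x) + x ^ Suc k * poly p x / exp x) \<longlongrightarrow> a * 0 + 0) at_top"
    by (intro tendsto_intros tendsto_power_div_exp_0 pCons.IH)
  then show ?case by (simp add: algebra_simps add_divide_distrib)
qed simp

text \<open>For positive x this is the product rule; \<open>[:0, 0, 1:]\<close> is the squared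
  indeterminate and supplies the factor 1/x^2 that comes from differentiating 1/x. At 0 both
  one-sided difference quotients tend to 0.\<close>

lemma flat_has_derivative:
  "(flat p has_real_derivative flat ([:0, 0, 1:] * (p - pderiv p)) x) (at x)"
proof -
  consider "x < 0" | "x = 0" | "x > 0" by linarith
  then show ?thesis
  proof cases
    case 1
    have "((\<lambda>_. 0) has_real_derivative 0) (at x)" by simp
    then have "(flat p has_real_derivative 0) (at x)"
      by (rule has_field_derivative_transform_within_open[of _ _ _ "{..<0}"])
         (use 1 in \<open>auto simp: flat_def\<close>)
    with 1 show ?thesis by (simp add: flat_def)
  next
    case 3
    have "((\<lambda>x. poly p (1 / x) * exp (- 1 / x)) has_real_derivative
        poly p (1 / x) * (exp (- 1 / x) * (1 / x\<^sup>2)) + poly (pderiv p) (1 / x) * (- 1 / x\<^sup>2) * exp (- 1 / x)) (at x)"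
      using 3 by (auto intro!: derivative_eq_intros DERIV_chain2[OF poly_DERIV]
          simp: power2_eq_square field_simps)
    also have "poly p (1 / x) * (exp (- 1 / x) * (1 / x\<^sup>2)) + poly (pderiv p) (1 / x) * (- 1 / x\<^sup>2) * exp (- 1 / x)
        = flat ([:0, 0, 1:] * (p - pderiv p)) x"
      using 3 by (simp add: flat_def power2_eq_square field_simps)
    finally show ?thesis
      by (rule has_field_derivative_transform_within_open[of _ _ _ "{0<..}"])
         (use 3 in \<open>auto simp: flat_def\<close>)
  next
    case 2
    \<comment> \<open>With u = 1/h the quotient becomes u * p(u) / exp u, and u tends to
      infinity.\<close>
    have "((\<lambda>h. flat p h / h) \<longlongrightarrow> 0) (at_right 0)"
    proof -
      have "((\<lambda>u. u ^ 1 * poly p u / exp u) \<longlongrightarrow> 0) at_top"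
        by (rule poly_div_exp_tendsto_0)
      then have "((\<lambda>h. inverse h ^ 1 * poly p (inverse h) / exp (inverse h)) \<longlongrightarrow> 0) (at_right 0)"
        by (rule filterlim_compose[OF _ filterlim_inverse_at_top_right])
      then show ?thesis
        by (rule filterlim_cong[THEN iffD1, OF refl refl, rotated])
           (auto simp: flat_def eventually_at_filter exp_minus field_simps)
    qed
    moreover have "((\<lambda>h. flat p h / h) \<longlongrightarrow> 0) (at_left 0)"
      by (rule tendsto_eventually) (auto simp: flat_def eventually_at_filter)
    ultimately have "((\<lambda>h. flat p h / h) \<longlongrightarrow> 0) (at 0)"
      by (simp add: filterlim_split_at)
    with 2 show ?thesis by (simp add: DERIV_def flat_def)
  qed
qed

lemma times_differentiable_flat: "times_differentiable k (flat p)"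
proof (induction k arbitrary: p)
  case 0
  then show ?case
    using flat_has_derivative by (auto intro!: DERIV_isCont continuous_at_imp_continuous_on)
next
  case (Suc k)
  show ?case
    by (rule times_differentiable_SucI[OF flat_has_derivative[unfolded has_field_derivative_def]])
       (use Suc in simp)
qed

text \<open>Take a bump supported between 0 and \<open>e\<close> and its primitive, and divide both
  by the mass of the bump. The primitive is smooth because its derivative is.\<close>

lemma smooth_step_exists:
  fixes e :: real
  assumes "0 < e"
  obtains R B :: "real \<Rightarrow> real"
  where "\<And>k. times_differentiable k R" "\<And>k. times_differentiable k B"
    and "\<And>x. (R has_real_derivative B x) (at x)" "\<And>x. 0 \<le> B x"
    and "\<And>x. x \<le> 0 \<or> e \<le> x \<Longrightarrow> B x = 0"
    and "\<And>x. x \<le> 0 \<Longrightarrow> R x = 0" "\<And>x. e \<le> x \<Longrightarrow> R x = 1"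
proof -
  \<comment> \<open>The arguments x and e - x are spelled out in the affine form of
    \<open>times_differentiable_compose_inner\<close>.\<close>
  define B where "B x = flat 1 (x \<bullet> 1 + 0) * flat 1 (x \<bullet> (-1) + e)" for x :: real
  have B_smooth: "times_differentiable k B" for k
    unfolding B_def
    by (intro times_differentiable_mult times_differentiable_compose_inner times_differentiable_flat)
  have B0: "B x = 0" if "x \<le> 0 \<or> e \<le> x" for x using that by (auto simp: B_def flat_def)
  have Bpos: "0 < B x" if "0 < x" "x < e" for x using that by (auto simp: B_def flat_def)
  then have Bnn: "0 \<le> B x" for x by (metis B0 linorder_not_less order_le_less)
  \<comment> \<open>Integration starts left of 0, so that every x >= 0 is interior to an interval of
    integration and the derivative is two-sided also at 0.\<close>
  define R where "R x = integral {- 1..x} B" for x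
  have cont: "continuous_on A B" for A
    using B_smooth[of 0] continuous_on_subset by fastforce
  have R0: "R x = 0" if "x \<le> 0" for x
  proof -
    have "R x = integral {- 1..x} (\<lambda>_. 0)"
      unfolding R_def by (rule integral_cong) (use that B0 in auto)
    then show ?thesis by simp
  qed
  have R': "(R has_real_derivative B x) (at x)" for x
  proof (cases "x < 0")
    case True
    have "((\<lambda>_. 0) has_real_derivative 0) (at x)" by simp
    then have "(R has_real_derivative 0) (at x)"
      by (rule has_field_derivative_transform_within_open[of _ _ _ "{..<0}"]) (use True R0 in auto)
    with True B0 show ?thesis by simp
  next
    case False
    have "(R has_real_derivative B x) (at x within {- 1..x + 1})"
      unfolding R_def using False by (intro integral_has_real_derivative cont) auto
    then show ?thesis
      using False by (subst (asm) at_within_Icc_at) auto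
  qed
  define m where "m = R e"
  have "R 0 < R e"
    by (rule DERIV_pos_imp_increasing_open[OF assms])
       (use R' Bpos in \<open>blast, auto intro!: DERIV_isCont continuous_at_imp_continuous_on\<close>)
  then have m: "m > 0" using R0[of 0] by (simp add: m_def)
  have Rm: "R x = m" if "e \<le> x" for x
  proof (cases "x = e")
    case False
    have "\<exists>z. z > e \<and> z < x \<and> R x - R e = (x - e) * B z"
      by (rule MVT2) (use R' that False in auto)
    then show ?thesis using B0 by (auto simp: m_def)
  qed (simp add: m_def)
  have R_smooth: "times_differentiable k R" for k
    by (rule times_differentiable_Suc_imp, rule times_differentiable_SucI[OF R'[unfolded has_field_derivative_def]])
       (simp add: B_smooth)
  show thesis
  proof (rule that[of "\<lambda>x. 1 / m * R x" "\<lambda>x. 1 / m * B x"])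
    show "((\<lambda>x. 1 / m * R x) has_real_derivative 1 / m * B x) (at x)" for x
      by (rule DERIV_cmult[OF R'])
    show "times_differentiable k (\<lambda>x. 1 / m * R x)" "times_differentiable k (\<lambda>x. 1 / m * B x)" for k
      by (rule times_differentiable_mult[OF times_differentiable_const R_smooth]
          times_differentiable_mult[OF times_differentiable_const B_smooth])+
  qed (use m R0 Rm B0 Bnn in auto)
qed

section \<open>Weak derivatives and increments\<close>

text \<open>As the product vanishes off \<open>S\<close>, its integral over \<open>S\<close> equals
  that over the whole space, which factorises by Tonelli.\<close>

lemma has_bochner_integral_prod_lebesgue_on:
  fixes F :: "'a::euclidean_space \<Rightarrow> real \<Rightarrow> real"
  assumes S: "S \<in> sets lebesgue"
    and F[measurable]: "\<And>i. i \<in> Basis \<Longrightarrow> F i \<in> borel_measurable borel"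
    and nn: "\<And>i x. i \<in> Basis \<Longrightarrow> 0 \<le> F i x"
    and int: "\<And>i. i \<in> Basis \<Longrightarrow> (\<integral>\<^sup>+x. F i x \<partial>lborel) = ennreal (c i)"
    and c: "\<And>i. i \<in> Basis \<Longrightarrow> 0 \<le> c i"
    and supp: "\<And>x. x \<notin> S \<Longrightarrow> (\<Prod>i\<in>Basis. F i (x \<bullet> i)) = 0"
  shows "has_bochner_integral (lebesgue_on S) (\<lambda>x. \<Prod>i\<in>Basis. F i (x \<bullet> i)) (\<Prod>i\<in>Basis. c i)"
proof (rule has_bochner_integral_nn_integral)
  let ?\<phi> = "\<lambda>x. \<Prod>i\<in>Basis. F i (x \<bullet> i)"
  have \<phi>[measurable]: "?\<phi> \<in> borel_measurable borel"
    by (intro borel_measurable_prod measurable_compose[OF _ F]) auto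
  show "?\<phi> \<in> borel_measurable (lebesgue_on S)"
    by (rule measurable_restrict_space1) (rule measurable_completion, simp)
  show "AE x in lebesgue_on S. 0 \<le> ?\<phi> x" by (intro AE_I2 prod_nonneg nn)
  show "0 \<le> prod c Basis" by (intro prod_nonneg c)
  have "(\<integral>\<^sup>+x. ?\<phi> x \<partial>lebesgue_on S) = (\<integral>\<^sup>+x. ennreal (?\<phi> x) * indicator S x \<partial>lebesgue)"
    using S by (simp add: nn_integral_restrict_space)
  also have "\<dots> = (\<integral>\<^sup>+x. ?\<phi> x \<partial>lebesgue)"
    by (intro nn_integral_cong) (auto simp: indicator_def supp)
  also have "\<dots> = (\<integral>\<^sup>+x. ?\<phi> x \<partial>lborel)" by (rule nn_integral_completion)
  also have "\<dots> = (\<integral>\<^sup>+x. (\<Prod>i\<in>Basis. ennreal (F i (x \<bullet> i))) \<partial>lborel)"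
    by (intro nn_integral_cong prod_ennreal[symmetric] nn)
  also have "\<dots> = (\<Prod>i\<in>Basis. (\<integral>\<^sup>+x. F i x \<partial>lborel))"
    by (rule nn_integral_lborel_prod) (auto intro: nn)
  also have "\<dots> = ennreal (prod c Basis)" by (simp add: int prod_ennreal c)
  finally show "(\<integral>\<^sup>+x. ?\<phi> x \<partial>lebesgue_on S) = ennreal (prod c Basis)" .
qed

text \<open>Where the density \<open>\<psi>\<close> is nonzero, \<open>f - c\<close> is at most
  \<open>\<eta>\<close>, so \<open>(f - c) * \<psi>\<close> is dominated by
  \<open>\<eta> * \<psi>\<close>. This yields integrability without any global bound on
  \<open>f\<close>.\<close>

lemma average_close:
  fixes f :: "'a \<Rightarrow> complex" and \<psi> :: "'a \<Rightarrow> real"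
  assumes f: "f \<in> borel_measurable N" and \<psi>: "has_bochner_integral N \<psi> 1"
    and nn: "\<And>x. 0 \<le> \<psi> x"
    and close: "\<And>x. x \<in> space N \<Longrightarrow> \<psi> x \<noteq> 0 \<Longrightarrow> cmod (f x - c) \<le> \<eta>"
  shows "integrable N (\<lambda>x. f x * \<psi> x)" and "cmod ((\<integral>x. f x * \<psi> x \<partial>N) - c) \<le> \<eta>"
proof -
  note [measurable] = f borel_measurable_has_bochner_integral[OF \<psi>]
  have \<psi>i: "integrable N \<psi>" and \<psi>1: "integral\<^sup>L N \<psi> = 1"
    using \<psi> by (auto simp: has_bochner_integral_iff)
  have b: "norm ((f x - c) * \<psi> x) \<le> \<eta> * \<psi> x" if "x \<in> space N" for x
    using close[OF that] nn[of x] by (cases "\<psi> x = 0") (auto simp: norm_mult intro: mult_right_mono)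
  have d: "integrable N (\<lambda>x. (f x - c) * \<psi> x)"
    by (rule Bochner_Integration.integrable_bound[where f = "\<lambda>x. \<eta> * \<psi> x"])
       (use \<psi>i b in \<open>auto intro!: AE_I2 order.trans[OF _ abs_ge_self]\<close>)
  have c\<psi>: "integrable N (\<lambda>x. c * \<psi> x)" using \<psi>i by simp
  show i: "integrable N (\<lambda>x. f x * \<psi> x)"
    using Bochner_Integration.integrable_add[OF d c\<psi>] by (simp add: algebra_simps)
  have "(\<integral>x. f x * \<psi> x \<partial>N) - (\<integral>x. c * \<psi> x \<partial>N) = (\<integral>x. (f x - c) * \<psi> x \<partial>N)"
    using Bochner_Integration.integral_diff[OF i c\<psi>] by (simp only: left_diff_distrib)
  moreover have "(\<integral>x. c * \<psi> x \<partial>N) = c" using \<psi>i by (simp add: \<psi>1)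
  ultimately have "(\<integral>x. f x * \<psi> x \<partial>N) - c = (\<integral>x. (f x - c) * \<psi> x \<partial>N)" by (simp only:)
  also have "cmod \<dots> \<le> (\<integral>x. \<eta> * \<psi> x \<partial>N)"
    by (rule order.trans[OF integral_norm_bound integral_mono])
       (use d \<psi>i b in \<open>auto intro: integrable_norm\<close>)
  also have "\<dots> = \<eta>" by (simp add: \<psi>1)
  finally show "cmod ((\<integral>x. f x * \<psi> x \<partial>N) - c) \<le> \<eta>" .
qed

text \<open>The test function \<open>\<phi>\<close> has derivative
  \<open>\<psi> p - \<psi> q\<close> along \<open>b\<close>, with \<open>\<psi> y\<close> a
  probability density near \<open>y\<close>. One side of the weak derivative identity is then nearly
  \<open>f p - f q\<close>; the other is at most \<open>M\<close> times the mass of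
  \<open>\<phi>\<close>, which is nearly \<open>h\<close>.\<close>

lemma weak_partial_increment_bound:
  fixes f g :: "'a::euclidean_space \<Rightarrow> complex"
  assumes S: "open S" and f: "continuous_on S f" and g: "has_weak_partial S b f g"
    and b: "b \<in> Basis" and g_le: "AE x in lebesgue_on S. cmod (g x) \<le> M" and M: "0 \<le> M"
    and h: "0 \<le> h" and seg: "closed_segment p (p + h *\<^sub>R b) \<subseteq> S"
  shows "cmod (f (p + h *\<^sub>R b) - f p) \<le> M * h"
proof -
  define q where "q = p + h *\<^sub>R b"
  have S': "S \<in> sets lebesgue" using S by auto
  have q_b: "q \<bullet> b = p \<bullet> b + h" and q_i: "i \<in> Basis \<Longrightarrow> i \<noteq> b \<Longrightarrow> q \<bullet> i = p \<bullet> i" for i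
    using b by (simp_all add: q_def inner_simps inner_not_same_Basis)
  have "p \<in> S" "q \<in> S" using seg by (auto simp: q_def)
  have f_meas: "f \<in> borel_measurable (lebesgue_on S)"
    using f S' by (rule continuous_imp_measurable_on_sets_lebesgue)
  \<comment> \<open>The summand \<open>2 * \<eta>\<close> pays for replacing the two point values by
    averages, and \<open>h + \<eta>\<close> bounds the mass of the test function. Finally
    \<open>\<eta>\<close> tends to 0.\<close>
  have main: "cmod (f q - f p) \<le> 2 * \<eta> + M * (h + \<eta>)" if \<eta>: "0 < \<eta>" for \<eta>
  proof -
    obtain \<epsilon>0 where \<epsilon>0: "0 < \<epsilon>0" "(\<Union>x\<in>closed_segment p q. cball x \<epsilon>0) \<subseteq> S"
      using compact_subset_open_imp_cball_epsilon_subset[OF compact_segment S] seg q_def by metis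
    obtain \<delta>1 where \<delta>1: "0 < \<delta>1" "\<And>x. x \<in> S \<Longrightarrow> dist x p < \<delta>1 \<Longrightarrow> dist (f x) (f p) < \<eta>"
      using f \<open>p \<in> S\<close> \<eta> unfolding continuous_on_iff by blast
    obtain \<delta>2 where \<delta>2: "0 < \<delta>2" "\<And>x. x \<in> S \<Longrightarrow> dist x q < \<delta>2 \<Longrightarrow> dist (f x) (f q) < \<eta>"
      using f \<open>q \<in> S\<close> \<eta> unfolding continuous_on_iff by blast
    \<comment> \<open>Points within \<open>r\<close> of the segment stay in \<open>S\<close>; the
      halves give the strict inequalities in the continuity conditions at \<open>p\<close> and
      \<open>q\<close>.\<close>
    define r where "r = min \<epsilon>0 (min (\<delta>1 / 2) (\<delta>2 / 2))"
    \<comment> \<open>Division by the dimension compensates the l1 estimate in \<open>near\<close>;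
      the minimum with \<open>\<eta>\<close> keeps the excess mass of the test function below
      \<open>\<eta>\<close>.\<close>
    define e where "e = min (r / DIM('a)) \<eta>"
    have "0 < r" using \<epsilon>0 \<delta>1 \<delta>2 by (simp add: r_def)
    then have e: "0 < e" "e \<le> \<eta>" "DIM('a) * e \<le> r"
      using \<eta> mult_left_mono[of e "r / DIM('a)" "DIM('a)"] by (auto simp: e_def)
    have near: "dist x y \<le> r" if "\<And>i. i \<in> Basis \<Longrightarrow> \<bar>x \<bullet> i - y \<bullet> i\<bar> \<le> e" for x y :: 'a
    proof -
      have "dist x y \<le> (\<Sum>i\<in>Basis. \<bar>(x - y) \<bullet> i\<bar>)" unfolding dist_norm by (rule norm_le_l1)
      also have "\<dots> \<le> (\<Sum>i\<in>(Basis :: 'a set). e)" by (intro sum_mono) (use that in \<open>simp add: inner_simps\<close>)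
      finally show ?thesis using e by simp
    qed
    obtain R B :: "real \<Rightarrow> real" where R: "\<And>k. times_differentiable k R"
      and B: "\<And>k. times_differentiable k B"
      and R': "\<And>x. (R has_real_derivative B x) (at x)" and B_nn: "\<And>x. 0 \<le> B x"
      and B0: "\<And>x. x \<le> 0 \<or> e \<le> x \<Longrightarrow> B x = 0"
      and R0: "\<And>x. x \<le> 0 \<Longrightarrow> R x = 0" and R1: "\<And>x. e \<le> x \<Longrightarrow> R x = 1"
      using smooth_step_exists[OF e(1)] by metis
    have [measurable]: "R \<in> borel_measurable borel" "B \<in> borel_measurable borel"
      using R[of 0] B[of 0] by (auto intro: borel_measurable_continuous_onI)
    have R_mono: "R x \<le> R y" if "x \<le> y" for x y
      by (rule DERIV_nonneg_imp_nondecreasing[OF that]) (use R' B_nn in blast)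
    have R_01: "0 \<le> R x" "R x \<le> 1" for x
      using R_mono[of "min x 0" x] R_mono[of x "max x e"] R0[of "min x 0"] R1[of "max x e"] by auto

    have R_shift: "((\<lambda>x. R (x + a)) has_real_derivative B (x + a)) (at x)" for a x
      using R'[of "x + a"] unfolding DERIV_shift .
    have B_int: "(\<integral>\<^sup>+x. B (x - a) \<partial>lborel) = 1" for a
    proof -
      have "(\<integral>\<^sup>+x. B (x - a) \<partial>lborel) = (\<integral>\<^sup>+x. ennreal (B (x - a)) * indicator {a..a + e} x \<partial>lborel)"
        by (intro nn_integral_cong) (auto simp: indicator_def B0)
      also have "\<dots> = R (a + e - a) - R (a - a)"
        by (rule nn_integral_FTC_Icc[of "\<lambda>x. B (x - a)" a "a + e" "\<lambda>x. R (x - a)"])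
           (use e B_nn R_shift[of "- a"] in auto)
      also have "\<dots> = 1" by (simp add: R0 R1)
      finally show ?thesis .
    qed

    \<comment> \<open>A smooth probability density supported in the cube of side \<open>e\<close>
      with lowest corner \<open>y\<close>.\<close>
    define \<psi> where "\<psi> y x = (\<Prod>i\<in>Basis. B (x \<bullet> i - y \<bullet> i))" for y x :: 'a
    have \<psi>_nn: "0 \<le> \<psi> y x" for x y unfolding \<psi>_def by (intro prod_nonneg B_nn)
    have \<psi>_supp: "dist x y \<le> r" if "\<psi> y x \<noteq> 0" for x y
    proof (rule near)
      fix i :: 'a assume "i \<in> Basis"
      with that have "B (x \<bullet> i - y \<bullet> i) \<noteq> 0" by (auto simp: \<psi>_def)
      then show "\<bar>x \<bullet> i - y \<bullet> i\<bar> \<le> e" using B0[of "x \<bullet> i - y \<bullet> i"] by force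
    qed
    have in_S: "x \<in> S" if "y \<in> closed_segment p q" "dist x y \<le> r" for x y
      using that \<epsilon>0(2) by (auto simp: r_def dist_commute subset_iff)
    have \<psi>_int: "has_bochner_integral (lebesgue_on S) (\<psi> y) 1" if "y \<in> closed_segment p q" for y
    proof -
      have "has_bochner_integral (lebesgue_on S) (\<psi> y) (\<Prod>i\<in>(Basis :: 'a set). 1)"
        unfolding \<psi>_def
      proof (rule has_bochner_integral_prod_lebesgue_on[OF S'])
        show "(\<Prod>i\<in>Basis. B (x \<bullet> i - y \<bullet> i)) = 0" if "x \<notin> S" for x
          using in_S[OF \<open>y \<in> closed_segment p q\<close> \<psi>_supp[of y x]] that unfolding \<psi>_def by blast
      qed (use B_nn B_int in auto)
      then show ?thesis by simp
    qed
    have near_p: "cmod (f x - f p) \<le> \<eta>" if "x \<in> S" "\<psi> p x \<noteq> 0" for x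
      using \<delta>1(2)[OF that(1)] \<psi>_supp[OF that(2)] \<delta>1(1) \<delta>2(1) by (simp add: r_def dist_norm)
    have near_q: "cmod (f x - f q) \<le> \<eta>" if "x \<in> S" "\<psi> q x \<noteq> 0" for x
      using \<delta>2(2)[OF that(1)] \<psi>_supp[OF that(2)] \<delta>1(1) \<delta>2(1) by (simp add: r_def dist_norm)
    have p_int: "integrable (lebesgue_on S) (\<lambda>x. f x * \<psi> p x)"
      and p_close: "cmod ((\<integral>x. f x * \<psi> p x \<partial>lebesgue_on S) - f p) \<le> \<eta>"
      by (rule average_close[OF f_meas \<psi>_int[OF ends_in_segment(1)] \<psi>_nn near_p]; simp)+
    have q_int: "integrable (lebesgue_on S) (\<lambda>x. f x * \<psi> q x)"
      and q_close: "cmod ((\<integral>x. f x * \<psi> q x \<partial>lebesgue_on S) - f q) \<le> \<eta>"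
      by (rule average_close[OF f_meas \<psi>_int[OF ends_in_segment(2)] \<psi>_nn near_q]; simp)+

    \<comment> \<open>\<open>\<phi>\<close> is the convolution of the bump \<open>\<psi> 0\<close> with arc length on the segment, written as a product\<close>
    define F where "F i s = (if i = b then R (s - p \<bullet> b) - R (s - q \<bullet> b) else B (s - p \<bullet> i))" for i s
    define \<phi> where "\<phi> x = (\<Prod>i\<in>Basis. F i (x \<bullet> i))" for x :: 'a
    have F_nn: "0 \<le> F i s" for i s
      using R_mono[of "s - q \<bullet> b" "s - p \<bullet> b"] h B_nn by (auto simp: F_def q_b)
    have \<phi>_nn: "0 \<le> \<phi> x" for x unfolding \<phi>_def by (intro prod_nonneg F_nn)
    have F_supp: "s \<in> {p \<bullet> i..q \<bullet> i + e}" if "i \<in> Basis" "F i s \<noteq> 0" for i s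
    proof (rule ccontr)
      assume s: "s \<notin> {p \<bullet> i..q \<bullet> i + e}"
      have "F i s = 0"
      proof (cases "i = b")
        case True
        with s h e show ?thesis by (cases "s < p \<bullet> b") (auto simp: F_def q_b R0 R1)
      next
        case False
        with s that(1) show ?thesis by (auto simp: F_def q_i intro!: B0)
      qed
      with that show False by simp
    qed
    \<comment> \<open>Each bump lies on the upper side of its base point, so only the upper corner
      is shifted by \<open>e\<close>.\<close>
    define Q where "Q = cbox p (q + e *\<^sub>R One)"
    have \<phi>_supp: "x \<in> Q" if "\<phi> x \<noteq> 0" for x
    proof -
      have "x \<bullet> i \<in> {p \<bullet> i..q \<bullet> i + e}" if "i \<in> Basis" for i
        by (rule F_supp[OF that]) (use \<open>\<phi> x \<noteq> 0\<close> that in \<open>auto simp: \<phi>_def\<close>)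
      then show ?thesis by (auto simp: Q_def mem_box inner_simps)
    qed
    have "Q \<subseteq> S"
    proof
      fix x assume "x \<in> Q"
      then have x: "p \<bullet> i \<le> x \<bullet> i" "x \<bullet> i \<le> q \<bullet> i + e" if "i \<in> Basis" for i
        using that by (auto simp: Q_def mem_box inner_simps)
      \<comment> \<open>Clamping the coordinate along \<open>b\<close> picks a point of the segment
        that differs from \<open>x\<close> by at most \<open>e\<close> in every coordinate.\<close>
      define l where "l = min (x \<bullet> b - p \<bullet> b) h"
      have l: "0 \<le> l" "l \<le> h" using x[OF b] h by (auto simp: l_def)
      have "p + l *\<^sub>R b \<in> closed_segment p q"
      proof (cases "h = 0")
        case False
        with l h show ?thesis unfolding in_segment q_def
          by (intro exI[of _ "l / h"]) (auto simp: algebra_simps)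
      qed (use l in simp)
      moreover have "dist x (p + l *\<^sub>R b) \<le> r"
      proof (rule near)
        fix i :: 'a assume i: "i \<in> Basis"
        show "\<bar>x \<bullet> i - (p + l *\<^sub>R b) \<bullet> i\<bar> \<le> e"
          using x[OF i] b i e by (cases "i = b") (auto simp: inner_simps inner_not_same_Basis q_i l_def q_b)
      qed
      ultimately show "x \<in> S" by (rule in_S)
    qed
    have \<phi>_smooth: "times_differentiable k \<phi>" for k
    proof -
      have "times_differentiable k (\<lambda>x. F i (x \<bullet> i))" for i
      proof (cases "i = b")
        case True
        with times_differentiable_diff[OF times_differentiable_compose_inner[OF R, of k b "- (p \<bullet> b)"]
            times_differentiable_compose_inner[OF R, of k b "- (q \<bullet> b)"]]
        show ?thesis by (simp add: F_def)
      next
        case False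
        with times_differentiable_compose_inner[OF B, of k i "- (p \<bullet> i)"]
        show ?thesis by (simp add: F_def)
      qed
      then show ?thesis unfolding \<phi>_def by (intro times_differentiable_prod) auto
    qed
    have "test_function S \<phi>"
    proof -
      have cl: "closure {x. \<phi> x \<noteq> 0} \<subseteq> Q"
        by (rule closure_minimal) (use \<phi>_supp in \<open>auto simp: Q_def closed_cbox\<close>)
      moreover have "compact Q" by (simp add: Q_def)
      ultimately have "compact (closure {x. \<phi> x \<noteq> 0})"
        using closed_Int_compact[of "closure {x. \<phi> x \<noteq> 0}" Q] by (simp add: Int_absorb2)
      with cl \<open>Q \<subseteq> S\<close> show ?thesis by (auto simp: test_function_def \<phi>_smooth)
    qed
    \<comment> \<open>Along \<open>b\<close> only the factor with the two steps varies, and its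
      derivative is a difference of bumps. The other factors are shared by \<open>\<psi> p\<close>
      and \<open>\<psi> q\<close>, since \<open>p\<close> and \<open>q\<close> agree in all
      coordinates but the one along \<open>b\<close>.\<close>
    have \<phi>': "frechet_derivative \<phi> (at x) b = \<psi> p x - \<psi> q x" for x
    proof -
      let ?P = "\<Prod>i\<in>Basis - {b}. B (x \<bullet> i - p \<bullet> i)"
      have bb: "b \<bullet> b = 1" using b by simp
      have "\<phi> (x + t *\<^sub>R b) = (R (x \<bullet> b + t - p \<bullet> b) - R (x \<bullet> b + t - q \<bullet> b)) * ?P" for t
      proof -
        have "(\<Prod>i\<in>Basis - {b}. F i ((x + t *\<^sub>R b) \<bullet> i)) = ?P"
          using b by (intro prod.cong) (auto simp: F_def inner_simps inner_not_same_Basis)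
        then show ?thesis
          unfolding \<phi>_def by (subst prod.remove[OF _ b]) (auto simp: F_def inner_simps bb)
      qed
      moreover have "((\<lambda>t. (R (x \<bullet> b + t - p \<bullet> b) - R (x \<bullet> b + t - q \<bullet> b)) * ?P) has_real_derivative
          (B (x \<bullet> b - p \<bullet> b) - B (x \<bullet> b - q \<bullet> b)) * ?P) (at 0)"
        using DERIV_cmult_right[OF DERIV_diff[OF R_shift[of "x \<bullet> b - p \<bullet> b" 0] R_shift[of "x \<bullet> b - q \<bullet> b" 0]], of ?P]
        by (simp add: algebra_simps)
      moreover have "B (x \<bullet> b - y \<bullet> b) * ?P = \<psi> y x" if "y = p \<or> y = q" for y
      proof -
        have "?P = (\<Prod>i\<in>Basis - {b}. B (x \<bullet> i - y \<bullet> i))"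
          using that by (intro prod.cong) (auto simp: q_i)
        then show ?thesis unfolding \<psi>_def by (subst prod.remove[OF _ b]) auto
      qed
      ultimately have "((\<lambda>t. \<phi> (x + t *\<^sub>R b)) has_real_derivative \<psi> p x - \<psi> q x) (at 0)"
        by (simp add: left_diff_distrib)
      moreover have "((\<lambda>t. \<phi> (x + t *\<^sub>R b)) has_real_derivative frechet_derivative \<phi> (at x) b) (at 0)"
      proof -
        have "((\<lambda>t. x + t *\<^sub>R b) has_derivative (\<lambda>t. t *\<^sub>R b)) (at 0)"
          by (auto intro!: derivative_eq_intros)
        moreover have D: "(\<phi> has_derivative frechet_derivative \<phi> (at x)) (at (x + 0 *\<^sub>R b))"
          using times_differentiable_SucD(1)[OF \<phi>_smooth] by simp
        ultimately have "((\<lambda>t. \<phi> (x + t *\<^sub>R b)) has_derivative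
            (\<lambda>t. frechet_derivative \<phi> (at x) (t *\<^sub>R b))) (at 0)"
          by (rule has_derivative_compose)
        then show ?thesis
          using linear_scale[OF has_derivative_linear[OF D]]
          by (simp add: has_field_derivative_def mult.commute[of _ "frechet_derivative \<phi> (at x) b"])
      qed
      ultimately show ?thesis by (rule DERIV_unique[symmetric])
    qed
    \<comment> \<open>A difference of two steps is at most 1 and lives on an interval of length
      \<open>h + e\<close>. The remaining factors of \<open>\<phi>\<close> have integral 1, so this
      bounds its whole mass.\<close>
    have F_b_le: "(\<integral>\<^sup>+s. F b s \<partial>lborel) \<le> ennreal (h + e)"
    proof -
      have "(\<integral>\<^sup>+s. F b s \<partial>lborel) \<le> (\<integral>\<^sup>+s. indicator {p \<bullet> b..q \<bullet> b + e} s \<partial>lborel)"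
      proof (intro nn_integral_mono)
        fix s
        have "F b s \<le> 1" using R_01[of "s - p \<bullet> b"] R_01[of "s - q \<bullet> b"] by (simp add: F_def)
        with F_supp[OF b, of s] show "ennreal (F b s) \<le> indicator {p \<bullet> b..q \<bullet> b + e} s"
          by (cases "F b s = 0") (auto simp: indicator_def)
      qed
      also have "\<dots> = ennreal (h + e)" using h e by (simp add: q_b algebra_simps)
      finally show ?thesis .
    qed
    then obtain c where c: "0 \<le> c" "(\<integral>\<^sup>+s. F b s \<partial>lborel) = ennreal c"
      by (cases "\<integral>\<^sup>+s. F b s \<partial>lborel") (auto simp: top_unique)
    have "c \<le> h + e" using F_b_le c h e by (simp del: ennreal_plus)
    have \<phi>_int: "has_bochner_integral (lebesgue_on S) \<phi> c"
    proof -
      have "has_bochner_integral (lebesgue_on S) \<phi> (\<Prod>i\<in>Basis. if i = b then c else 1)"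
        unfolding \<phi>_def
      proof (rule has_bochner_integral_prod_lebesgue_on[OF S'])
        show "F i \<in> borel_measurable borel" for i
          unfolding F_def by (cases "i = b") auto
        show "(\<integral>\<^sup>+x. F i x \<partial>lborel) = ennreal (if i = b then c else 1)" for i
          using B_int c by (cases "i = b") (auto simp: F_def)
        show "(\<Prod>i\<in>Basis. F i (x \<bullet> i)) = 0" if "x \<notin> S" for x
          using that \<phi>_supp[of x] \<open>Q \<subseteq> S\<close> by (auto simp: \<phi>_def)
      qed (use F_nn c in auto)
      then show ?thesis using b by (simp add: prod.delta)
    qed
    have "(\<integral>x. f x * \<psi> p x \<partial>lebesgue_on S) - (\<integral>x. f x * \<psi> q x \<partial>lebesgue_on S)
        = (\<integral>x. f x * of_real (frechet_derivative \<phi> (at x) b) \<partial>lebesgue_on S)"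
      using p_int q_int by (simp add: \<phi>' algebra_simps)
    also have "\<dots> = - (\<integral>x. g x * of_real (\<phi> x) \<partial>lebesgue_on S)"
      using g \<open>test_function S \<phi>\<close> by (simp add: has_weak_partial_def)
    finally have eq: "(\<integral>x. f x * \<psi> p x \<partial>lebesgue_on S) - (\<integral>x. f x * \<psi> q x \<partial>lebesgue_on S)
        = - (\<integral>x. g x * of_real (\<phi> x) \<partial>lebesgue_on S)" .
    have "cmod (\<integral>x. g x * of_real (\<phi> x) \<partial>lebesgue_on S) \<le> (\<integral>x. M * \<phi> x \<partial>lebesgue_on S)"
    proof -
      have M\<phi>: "integrable (lebesgue_on S) (\<lambda>x. M * \<phi> x)"
        using \<phi>_int by (auto simp: has_bochner_integral_iff)
      have le: "AE x in lebesgue_on S. norm (g x * of_real (\<phi> x)) \<le> M * \<phi> x"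
        using g_le by eventually_elim (auto simp: norm_mult \<phi>_nn intro: mult_right_mono)
      have "cmod (\<integral>x. g x * of_real (\<phi> x) \<partial>lebesgue_on S)
          \<le> (\<integral>x. norm (g x * of_real (\<phi> x)) \<partial>lebesgue_on S)"
        by (rule integral_norm_bound)
      also have "\<dots> \<le> (\<integral>x. M * \<phi> x \<partial>lebesgue_on S)"
        by (rule integral_mono_AE'[OF M\<phi> le]) (auto simp: M \<phi>_nn)
      finally show ?thesis .
    qed
    also have "\<dots> = M * c" using \<phi>_int by (simp add: has_bochner_integral_iff)
    also have "\<dots> \<le> M * (h + \<eta>)" using \<open>c \<le> h + e\<close> e M by (intro mult_left_mono) auto
    finally have "cmod ((\<integral>x. f x * \<psi> p x \<partial>lebesgue_on S) - (\<integral>x. f x * \<psi> q x \<partial>lebesgue_on S)) \<le> M * (h + \<eta>)"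
      by (simp add: eq)
    moreover have "cmod (f q - f p) \<le> cmod (P - f p) + cmod (Q - f q) + cmod (P - Q)" for P Q
    proof -
      have "f q - f p = (P - f p) - (Q - f q) - (P - Q)" by simp
      then show ?thesis by (smt (verit) norm_triangle_ineq4)
    qed
    ultimately show ?thesis using p_close q_close by (smt (verit))
  qed
  have "((\<lambda>\<eta>. 2 * \<eta> + M * (h + \<eta>)) \<longlongrightarrow> 2 * 0 + M * (h + 0)) (at_right 0)"
    by (intro tendsto_intros)
  moreover have "eventually (\<lambda>\<eta>. cmod (f q - f p) \<le> 2 * \<eta> + M * (h + \<eta>)) (at_right 0)"
    using main by (auto simp: eventually_at_filter)
  ultimately have "cmod (f q - f p) \<le> 2 * 0 + M * (h + 0)"
    by (rule tendsto_lowerbound) simp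
  then show ?thesis by (simp add: q_def)
qed

section \<open>Essential suprema and Lipschitz bounds for functions with bounded weak
  derivatives\<close>

lemma Linf_norm_nonneg: "0 \<le> Linf_norm S f"
proof -
  let ?M = "lebesgue_on S" and ?f = "\<lambda>x. ereal (cmod (f x))"
  \<comment> \<open>In the first two cases the essential supremum is plus or minus infinity, which
    \<open>real_of_ereal\<close> sends to 0; in the third, comparison with the constant 0
    applies.\<close>
  consider "?f \<notin> borel_measurable ?M" | "?f \<in> borel_measurable ?M" "emeasure ?M (space ?M) = 0"
    | "?f \<in> borel_measurable ?M" "emeasure ?M (space ?M) \<noteq> 0" by blast
  then show ?thesis
  proof cases
    case 1
    then show ?thesis by (simp add: Linf_norm_def esssup_non_measurable top_ereal_def)
  next
    case 2
    then show ?thesis using esssup_zero_space[OF 2(2), of ?f] by (simp add: Linf_norm_def bot_ereal_def)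
  next
    case 3
    have "esssup ?M (\<lambda>_. 0 :: ereal) \<le> esssup ?M ?f" by (rule esssup_mono) (use 3 in auto)
    then show ?thesis unfolding esssup_const[OF 3(2)] Linf_norm_def by (rule real_of_ereal_pos)
  qed
qed

lemma AE_le_Linf_norm:
  assumes "f \<in> Linf S"
  shows "AE x in lebesgue_on S. cmod (f x) \<le> Linf_norm S f"
proof -
  let ?e = "esssup (lebesgue_on S) (\<lambda>x. ereal (cmod (f x)))"
  have "AE x in lebesgue_on S. ereal (cmod (f x)) \<le> ?e" by (rule esssup_AE)
  moreover have "?e \<noteq> \<infinity>" using assms by (auto simp: Linf_def)
  \<comment> \<open>If \<open>?e\<close> is minus infinity, the almost everywhere inequality is
    pointwise impossible, so it implies the claim vacuously.\<close>
  ultimately show ?thesis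
    unfolding Linf_norm_def by (cases ?e) (auto elim!: eventually_mono)
qed

lemma W1inf_increment_bound:
  assumes "open S" "convex S" "f \<in> W1inf S" "continuous_on S f" "b \<in> Basis"
    and "0 \<le> h" "p \<in> S" "p + h *\<^sub>R b \<in> S"
  shows "cmod (f (p + h *\<^sub>R b) - f p) \<le> Linf_norm S (weak_partial S b f) * h"
proof (rule weak_partial_increment_bound)
  from assms have "\<exists>g. has_weak_partial S b f g" and Li: "weak_partial S b f \<in> Linf S"
    by (auto simp: W1inf_def)
  then show "has_weak_partial S b f (weak_partial S b f)"
    unfolding weak_partial_def by (metis someI_ex)
  show "AE x in lebesgue_on S. cmod (weak_partial S b f x) \<le> Linf_norm S (weak_partial S b f)"
    using Li by (rule AE_le_Linf_norm)
  show "closed_segment p (p + h *\<^sub>R b) \<subseteq> S"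
    using assms by (intro closed_segment_subset) auto
qed (use assms Linf_norm_nonneg in auto)

section \<open>Lebesgue measurability on products\<close>

text \<open>Borel representatives are used because \<open>lborel\<close> on a product is the product
  of the \<open>lborel\<close> measures, whereas the product of two completions is not itself
  complete.\<close>

lemma lebesgue_on_integrable_ex_borel:
  fixes a :: "'a::euclidean_space \<Rightarrow> real"
  assumes A: "A \<in> sets lebesgue" and a: "integrable (lebesgue_on A) a"
  obtains a' N where "integrable lborel a'" "N \<in> null_sets lborel"
    "\<And>x. x \<notin> N \<Longrightarrow> indicator A x *\<^sub>R a x = a' x"
proof -
  have i: "integrable lebesgue (\<lambda>x. indicator A x *\<^sub>R a x)"
    using a A by (subst (asm) integrable_restrict_space) auto
  then obtain a' where a'[measurable]: "a' \<in> borel_measurable lborel"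
    and ae: "AE x in lborel. indicator A x *\<^sub>R a x = a' x"
    using completion_ex_borel_measurable_real[of "\<lambda>x. indicator A x *\<^sub>R a x" lborel] by blast
  have "integrable lebesgue a'"
    using i by (rule integrable_cong_AE_imp) (use AE_completion[OF ae] in \<open>auto intro: measurable_completion\<close>)
  then have "integrable lborel a'" using a' by (subst (asm) integrable_completion) auto
  moreover from ae obtain N where "N \<in> null_sets lborel" "\<And>x. x \<notin> N \<Longrightarrow> indicator A x *\<^sub>R a x = a' x"
    by (rule AE_E3) auto
  ultimately show thesis using that by blast
qed

text \<open>A map into a completion must pull null sets back to null sets. Here the preimage of a
  null set is a cylinder, of measure 0 times infinity, which is 0.\<close>

lemma measurable_lebesgue_fst: "fst \<in> (lebesgue :: ('a::euclidean_space \<times> 'b::euclidean_space) measure) \<rightarrow>\<^sub>M lebesgue"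
  and measurable_lebesgue_snd: "snd \<in> (lebesgue :: ('a \<times> 'b) measure) \<rightarrow>\<^sub>M lebesgue"
proof -
  have m: "fst \<in> (lebesgue :: ('a \<times> 'b) measure) \<rightarrow>\<^sub>M lborel" "snd \<in> (lebesgue :: ('a \<times> 'b) measure) \<rightarrow>\<^sub>M lborel"
    by (intro measurable_completion;
        auto intro!: borel_measurable_continuous_onI continuous_on_fst continuous_on_snd continuous_on_id)+
  have N: "N \<times> (UNIV :: 'b set) \<in> null_sets lborel" if "N \<in> null_sets lborel" for N :: "'a set"
    using that by (auto simp: null_sets_def lborel_prod[symmetric] lborel.emeasure_pair_measure_Times)
  have N': "(UNIV :: 'a set) \<times> N \<in> null_sets lborel" if "N \<in> null_sets lborel" for N :: "'b set"
    using that by (auto simp: null_sets_def lborel_prod[symmetric] lborel.emeasure_pair_measure_Times)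
  have "null_sets lborel \<subseteq> null_sets (distr (lebesgue :: ('a \<times> 'b) measure) lborel fst)"
  proof
    show "A \<in> null_sets (distr (lebesgue :: ('a \<times> 'b) measure) lborel fst)" if "A \<in> null_sets lborel" for A
      using null_sets_completionI[OF N[OF that]] null_setsD2[OF that] m
      by (simp add: null_sets_distr_iff fst_vimage_eq_Times)
  qed
  then show "fst \<in> (lebesgue :: ('a \<times> 'b) measure) \<rightarrow>\<^sub>M lebesgue"
    by (rule completion.measurable_completion2[OF m(1)])
  have "null_sets lborel \<subseteq> null_sets (distr (lebesgue :: ('a \<times> 'b) measure) lborel snd)"
  proof
    show "A \<in> null_sets (distr (lebesgue :: ('a \<times> 'b) measure) lborel snd)" if "A \<in> null_sets lborel" for A
      using null_sets_completionI[OF N'[OF that]] null_setsD2[OF that] m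
      by (simp add: null_sets_distr_iff snd_vimage_eq_Times)
  qed
  then show "snd \<in> (lebesgue :: ('a \<times> 'b) measure) \<rightarrow>\<^sub>M lebesgue"
    by (rule completion.measurable_completion2[OF m(2)])
qed

lemma sets_lebesgue_Times:
  assumes "A \<in> sets lebesgue" "B \<in> sets lebesgue"
  shows "A \<times> B \<in> sets (lebesgue :: ('a::euclidean_space \<times> 'b::euclidean_space) measure)"
proof -
  have "A \<times> B = (fst -` A \<inter> space lebesgue) \<inter> (snd -` B \<inter> space lebesgue)" by auto
  then show ?thesis
    using measurable_sets[OF measurable_lebesgue_fst assms(1)] measurable_sets[OF measurable_lebesgue_snd assms(2)]
    by (metis sets.Int)
qed

lemma measurable_lebesgue_on_fst: "fst \<in> lebesgue_on (A \<times> B) \<rightarrow>\<^sub>M lebesgue_on A"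
  and measurable_lebesgue_on_snd: "snd \<in> lebesgue_on (A \<times> B) \<rightarrow>\<^sub>M lebesgue_on B"
  for A :: "'a::euclidean_space set" and B :: "'b::euclidean_space set"
  by (intro measurable_restrict_space3 measurable_lebesgue_fst measurable_lebesgue_snd; auto)+

text \<open>Fubini applies to the Borel representatives; the exceptional sets of the two factors
  only contribute null cylinders in the product.\<close>

lemma integrable_lebesgue_on_Times:
  fixes a :: "'a::euclidean_space \<Rightarrow> real" and b :: "'b::euclidean_space \<Rightarrow> real"
  assumes A: "A \<in> sets lebesgue" and B: "B \<in> sets lebesgue"
    and a: "integrable (lebesgue_on A) a" and b: "integrable (lebesgue_on B) b"
  shows "integrable (lebesgue_on (A \<times> B)) (\<lambda>x. a (fst x) * b (snd x))"
proof -
  obtain a' N where a': "integrable lborel a'" "N \<in> null_sets lborel"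
    "\<And>x. x \<notin> N \<Longrightarrow> indicator A x *\<^sub>R a x = a' x"
    using lebesgue_on_integrable_ex_borel[OF A a] by blast
  obtain b' N' where b': "integrable lborel b'" "N' \<in> null_sets lborel"
    "\<And>x. x \<notin> N' \<Longrightarrow> indicator B x *\<^sub>R b x = b' x"
    using lebesgue_on_integrable_ex_borel[OF B b] by blast
  have [measurable]: "a' \<in> borel_measurable borel" "b' \<in> borel_measurable borel"
    using a'(1) b'(1) by auto
  have "integrable (lborel \<Otimes>\<^sub>M lborel) (\<lambda>x. a' (fst x) * b' (snd x))"
    by (rule lborel_pair.Fubini_integrable) (use a'(1) b'(1) in \<open>auto simp: abs_mult integrable_abs\<close>)
  then have "integrable lborel (\<lambda>x :: 'a \<times> 'b. a' (fst x) * b' (snd x))" by (simp add: lborel_prod)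
  then have i: "integrable lebesgue (\<lambda>x :: 'a \<times> 'b. a' (fst x) * b' (snd x))"
    by (subst integrable_completion) auto
  have "N \<times> (UNIV :: 'b set) \<in> null_sets lborel" "(UNIV :: 'a set) \<times> N' \<in> null_sets lborel"
    using a'(2) b'(2) by (auto simp: null_sets_def lborel_prod[symmetric] lborel.emeasure_pair_measure_Times)
  then have "(N \<times> UNIV) \<union> (UNIV \<times> N') \<in> null_sets (lebesgue :: ('a \<times> 'b) measure)"
    by (intro null_sets_completionI null_sets.Un)
  then have ae: "AE x in lebesgue. a' (fst x) * b' (snd x) = indicator (A \<times> B) x *\<^sub>R (a (fst x) * b (snd x))"
  proof (rule AE_I')
    have "a' (fst x) * b' (snd x) = indicator (A \<times> B) x *\<^sub>R (a (fst x) * b (snd x))"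
      if "fst x \<notin> N" "snd x \<notin> N'" for x
      using a'(3)[OF that(1)] b'(3)[OF that(2)] by (auto simp: indicator_def mem_Times_iff split: if_splits)
    then show "{x \<in> space lebesgue. a' (fst x) * b' (snd x) \<noteq>
        indicator (A \<times> B) x *\<^sub>R (a (fst x) * b (snd x))} \<subseteq> N \<times> UNIV \<union> UNIV \<times> N'"
      unfolding subset_iff mem_Collect_eq Un_iff mem_Times_iff by blast
  qed
  have AB: "A \<times> B \<in> sets lebesgue" by (rule sets_lebesgue_Times[OF A B])
  have [measurable]: "(\<lambda>x. a (fst x)) \<in> borel_measurable (lebesgue_on (A \<times> B))"
    "(\<lambda>x. b (snd x)) \<in> borel_measurable (lebesgue_on (A \<times> B))"
    using a b by (auto intro: measurable_compose[OF measurable_lebesgue_on_fst] measurable_compose[OF measurable_lebesgue_on_snd])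
  have "(\<lambda>x. a (fst x) * b (snd x)) \<in> borel_measurable (lebesgue_on (A \<times> B))" by measurable
  then have "(\<lambda>x. indicator (A \<times> B) x *\<^sub>R (a (fst x) * b (snd x))) \<in> borel_measurable lebesgue"
    using AB by (subst (asm) borel_measurable_restrict_space_iff) auto
  from integrable_cong_AE_imp[OF i this ae]
  show ?thesis using AB by (subst integrable_restrict_space) auto
qed

section \<open>Bilinear forms with square-integrable kernel\<close>

lemma L2_mult_bounded:
  assumes u: "u \<in> L2 S" and w: "w \<in> borel_measurable (lebesgue_on S)"
    and le: "\<And>x. x \<in> S \<Longrightarrow> cmod (w x) \<le> c" and c: "0 \<le> c"
  shows "(\<lambda>x. w x * u x) \<in> L2 S" and "L2_norm S (\<lambda>x. w x * u x) \<le> c * L2_norm S u"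
proof -
  have [measurable]: "u \<in> borel_measurable (lebesgue_on S)" and i: "integrable (lebesgue_on S) (\<lambda>x. (cmod (u x))\<^sup>2)"
    using u by (auto simp: L2_def)
  note [measurable] = w
  have b: "(cmod (w x * u x))\<^sup>2 \<le> c\<^sup>2 * (cmod (u x))\<^sup>2" if "x \<in> space (lebesgue_on S)" for x
    unfolding norm_mult power_mult_distrib using le[of x] that
    by (intro mult_right_mono power_mono) auto
  have i2: "integrable (lebesgue_on S) (\<lambda>x. c\<^sup>2 * (cmod (u x))\<^sup>2)" using i by simp
  have i3: "integrable (lebesgue_on S) (\<lambda>x. (cmod (w x * u x))\<^sup>2)"
    by (rule Bochner_Integration.integrable_bound[OF i2]) (use b in \<open>auto intro!: AE_I2\<close>)
  then show "(\<lambda>x. w x * u x) \<in> L2 S" by (simp add: L2_def)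
  have "(\<integral>x. (cmod (w x * u x))\<^sup>2 \<partial>lebesgue_on S) \<le> (\<integral>x. c\<^sup>2 * (cmod (u x))\<^sup>2 \<partial>lebesgue_on S)"
    by (rule integral_mono[OF i3 i2 b])
  then show "L2_norm S (\<lambda>x. w x * u x) \<le> c * L2_norm S u"
    unfolding L2_norm_def using c real_sqrt_le_mono by (fastforce simp: real_sqrt_mult)
qed

text \<open>The integrand is dominated by |K|^2 + |u|^2 |v|^2, whose second summand is integrable as
  a product of functions of separate variables.\<close>

lemma integrable_L2_kernel:
  fixes A :: "'a::euclidean_space set" and B :: "'b::euclidean_space set"
  assumes A: "A \<in> sets lebesgue" and B: "B \<in> sets lebesgue"
    and K: "K \<in> L2 (A \<times> B)" and u: "u \<in> L2 A" and v: "v \<in> L2 B"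
  shows "integrable (lebesgue_on (A \<times> B)) (\<lambda>x. K x * u (fst x) * cnj (v (snd x)))"
proof -
  have [measurable]: "K \<in> borel_measurable (lebesgue_on (A \<times> B))"
    "(\<lambda>x. u (fst x)) \<in> borel_measurable (lebesgue_on (A \<times> B))"
    "(\<lambda>x. v (snd x)) \<in> borel_measurable (lebesgue_on (A \<times> B))"
    using K u v
    by (auto simp: L2_def intro: measurable_compose[OF measurable_lebesgue_on_fst]
        measurable_compose[OF measurable_lebesgue_on_snd])
  have "(\<lambda>x. cnj (v (snd x))) \<in> borel_measurable (lebesgue_on (A \<times> B))"
    by (rule measurable_compose[of "\<lambda>x. v (snd x)" _ borel cnj])
       (auto intro: borel_measurable_continuous_onI continuous_intros)
  note [measurable] = this
  have uv: "integrable (lebesgue_on (A \<times> B)) (\<lambda>x. (cmod (u (fst x)))\<^sup>2 * (cmod (v (snd x)))\<^sup>2)"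
    using u v by (intro integrable_lebesgue_on_Times[OF A B]) (auto simp: L2_def)
  have "integrable (lebesgue_on (A \<times> B)) (\<lambda>x. (cmod (K x))\<^sup>2)" using K by (simp add: L2_def)
  from Bochner_Integration.integrable_add[OF this uv]
  show ?thesis
  proof (rule Bochner_Integration.integrable_bound)
    have "cmod (K x * u (fst x) * cnj (v (snd x)))
        \<le> (cmod (K x))\<^sup>2 + (cmod (u (fst x)))\<^sup>2 * (cmod (v (snd x)))\<^sup>2" for x
    proof -
      let ?k = "cmod (K x)" and ?w = "cmod (u (fst x)) * cmod (v (snd x))"
      have "2 * (?k * ?w) \<le> ?k\<^sup>2 + ?w\<^sup>2" using sum_squares_bound[of ?k ?w] by simp
      moreover have "0 \<le> ?k * ?w" by simp
      ultimately have "?k * ?w \<le> ?k\<^sup>2 + ?w\<^sup>2" by linarith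
      then show ?thesis by (simp add: norm_mult power_mult_distrib mult.assoc)
    qed
    then show "AE x in lebesgue_on (A \<times> B). norm (K x * u (fst x) * cnj (v (snd x)))
        \<le> norm ((cmod (K x))\<^sup>2 + (cmod (u (fst x)))\<^sup>2 * (cmod (v (snd x)))\<^sup>2)"
      by (intro AE_I2) (simp add: order.trans[OF _ abs_ge_self])
  qed measurable
qed

context
  fixes A :: "'a::euclidean_space set" and B :: "'b::euclidean_space set"
    and K :: "'a \<times> 'b \<Rightarrow> complex" and C :: real
  assumes A: "A \<in> sets lebesgue" and B: "B \<in> sets lebesgue" and K: "K \<in> L2 (A \<times> B)"
    and C: "0 \<le> C"
    and bound: "\<And>u v. u \<in> L2 A \<Longrightarrow> v \<in> L2 B \<Longrightarrow>
      cmod (\<integral>x. K x * u (fst x) * cnj (v (snd x)) \<partial>lebesgue_on (A \<times> B)) \<le> C * L2_norm A u * L2_norm B v"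
begin

text \<open>A factor in one variable can be absorbed into \<open>u\<close> or \<open>v\<close>. The
  factor \<open>z\<close> is conjugated first, because \<open>v\<close> enters the form
  conjugated.\<close>

lemma bilinear_bound_mult:
  assumes u: "u \<in> L2 A" and v: "v \<in> L2 B"
    and w: "w \<in> borel_measurable (lebesgue_on A)" "\<And>s. s \<in> A \<Longrightarrow> cmod (w s) \<le> c" "0 \<le> c"
    and z: "z \<in> borel_measurable (lebesgue_on B)" "\<And>t. t \<in> B \<Longrightarrow> cmod (z t) \<le> d" "0 \<le> d"
  shows "integrable (lebesgue_on (A \<times> B))
      (\<lambda>x. w (fst x) * z (snd x) * (K x * u (fst x) * cnj (v (snd x))))" (is "integrable _ ?F")
    and "cmod (\<integral>x. w (fst x) * z (snd x) * (K x * u (fst x) * cnj (v (snd x))) \<partial>lebesgue_on (A \<times> B))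
      \<le> c * d * (C * L2_norm A u * L2_norm B v)"
proof -
  have cz: "(\<lambda>t. cnj (z t)) \<in> borel_measurable (lebesgue_on B)"
    by (rule measurable_compose[OF z(1)]) (intro borel_measurable_continuous_onI continuous_intros)
  note wu = L2_mult_bounded[OF u w]
  have zv: "(\<lambda>t. cnj (z t) * v t) \<in> L2 B" "L2_norm B (\<lambda>t. cnj (z t) * v t) \<le> d * L2_norm B v"
    using L2_mult_bounded[OF v cz, of d] z by auto
  have eq: "?F = (\<lambda>x. K x * (w (fst x) * u (fst x)) * cnj (cnj (z (snd x)) * v (snd x)))"
    by (simp add: fun_eq_iff algebra_simps)
  show "integrable (lebesgue_on (A \<times> B)) ?F"
    unfolding eq by (rule integrable_L2_kernel[OF A B K wu(1) zv(1)])
  have "cmod (\<integral>x. ?F x \<partial>lebesgue_on (A \<times> B))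
      \<le> C * L2_norm A (\<lambda>s. w s * u s) * L2_norm B (\<lambda>t. cnj (z t) * v t)"
    unfolding eq by (rule bound[OF wu(1) zv(1)])
  also have "\<dots> \<le> C * (c * L2_norm A u) * (d * L2_norm B v)"
    using wu(2) zv(2) C w(3) z(3)
    by (intro mult_mono mult_left_mono mult_nonneg_nonneg) (auto simp: L2_norm_def)
  finally show "cmod (\<integral>x. ?F x \<partial>lebesgue_on (A \<times> B)) \<le> c * d * (C * L2_norm A u * L2_norm B v)"
    by (simp add: mult_ac)
qed

text \<open>In the application \<open>J\<close> has N elements and \<open>c * d\<close> is of order
  T/N, so the total cost stays bounded as the grid is refined.\<close>

lemma bilinear_bound_separable_sum:
  fixes w :: "'i \<Rightarrow> 'a \<Rightarrow> complex" and z :: "'i \<Rightarrow> 'b \<Rightarrow> complex"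
  assumes u: "u \<in> L2 A" and v: "v \<in> L2 B"
    and w: "\<And>k. k \<in> J \<Longrightarrow> w k \<in> borel_measurable (lebesgue_on A)"
      "\<And>k s. k \<in> J \<Longrightarrow> s \<in> A \<Longrightarrow> cmod (w k s) \<le> c" "0 \<le> c"
    and z: "\<And>k. k \<in> J \<Longrightarrow> z k \<in> borel_measurable (lebesgue_on B)"
      "\<And>k t. k \<in> J \<Longrightarrow> t \<in> B \<Longrightarrow> cmod (z k t) \<le> d" "0 \<le> d"
  shows "integrable (lebesgue_on (A \<times> B))
      (\<lambda>x. (\<Sum>k\<in>J. w k (fst x) * z k (snd x)) * (K x * u (fst x) * cnj (v (snd x))))"
    and "cmod (\<integral>x. (\<Sum>k\<in>J. w k (fst x) * z k (snd x)) * (K x * u (fst x) * cnj (v (snd x)))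
        \<partial>lebesgue_on (A \<times> B)) \<le> real (card J) * (c * d * (C * L2_norm A u * L2_norm B v))"
proof -
  note * = bilinear_bound_mult[OF u v w(1,2,3) z(1,2,3)]
  show "integrable (lebesgue_on (A \<times> B))
      (\<lambda>x. (\<Sum>k\<in>J. w k (fst x) * z k (snd x)) * (K x * u (fst x) * cnj (v (snd x))))"
    unfolding sum_distrib_right by (intro Bochner_Integration.integrable_sum *(1))
  have "(\<integral>x. (\<Sum>k\<in>J. w k (fst x) * z k (snd x)) * (K x * u (fst x) * cnj (v (snd x))) \<partial>lebesgue_on (A \<times> B))
      = (\<Sum>k\<in>J. \<integral>x. w k (fst x) * z k (snd x) * (K x * u (fst x) * cnj (v (snd x))) \<partial>lebesgue_on (A \<times> B))"
    unfolding sum_distrib_right by (intro Bochner_Integration.integral_sum *(1))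
  also have "cmod \<dots> \<le> (\<Sum>k\<in>J. c * d * (C * L2_norm A u * L2_norm B v))"
    by (intro sum_norm_le *(2))
  finally show "cmod (\<integral>x. (\<Sum>k\<in>J. w k (fst x) * z k (snd x)) * (K x * u (fst x) * cnj (v (snd x)))
        \<partial>lebesgue_on (A \<times> B)) \<le> real (card J) * (c * d * (C * L2_norm A u * L2_norm B v))"
    by simp
qed

end

text \<open>Testing with \<open>u = v = 1\<close> gives \<open>0 \<le> C * T\<close>. The sign is
  what makes the bound monotone in the norms of \<open>u\<close> and \<open>v\<close>.\<close>

lemma bilinear_bound_nonneg:
  assumes "0 < T"
    and "\<And>u v. u \<in> L2 {0<..<T} \<Longrightarrow> v \<in> L2 {0<..<T} \<Longrightarrow>
      0 \<le> C * L2_norm {0<..<T::real} u * L2_norm {0<..<T} v"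
  shows "0 \<le> C"
proof -
  have "integrable (lebesgue_on {0<..<T}) (\<lambda>_. 1 :: real)"
    by (subst integrable_restrict_space) (use assms(1) in \<open>auto simp: integrable_indicator_iff\<close>)
  then have 1: "(\<lambda>_. 1) \<in> L2 {0<..<T}" by (simp add: L2_def)
  have "L2_norm {0<..<T} (\<lambda>_. 1) = sqrt T"
    using assms(1) by (simp add: L2_norm_def measure_restrict_space)
  with assms(2)[OF 1 1] assms(1) have "0 \<le> C * T" by (simp add: mult.assoc)
  with assms(1) show ?thesis by (simp add: zero_le_mult_iff)
qed

section \<open>Comparison with a grid\<close>

text \<open>The sum runs over the cells contained in the interval from \<open>t\<close> to
  \<open>s\<close> and telescopes to the increment between the extreme nodes there. Each end leaves
  a piece shorter than \<open>d\<close>, costing at most \<open>M * d\<close>.\<close>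

lemma grid_telescoping:
  fixes f :: "real \<Rightarrow> complex"
  assumes d: "0 < d" and N: "s \<le> real N * d" and ts: "0 \<le> t" "t \<le> s"
    and lip: "\<And>x y. t \<le> x \<Longrightarrow> x \<le> y \<Longrightarrow> y \<le> s \<Longrightarrow> cmod (f y - f x) \<le> M * (y - x)"
    and M: "0 \<le> M"
  shows "cmod (f s - f t - (\<Sum>k<N. if t \<le> real k * d \<and> real (Suc k) * d \<le> s
           then f (real (Suc k) * d) - f (real k * d) else 0)) \<le> 2 * M * d"
proof -
  \<comment> \<open>\<open>a\<close> indexes the first node not below \<open>t\<close>, and
    \<open>b\<close> the last node not above \<open>s\<close>.\<close>
  define a where "a = nat \<lceil>t / d\<rceil>"
  define b where "b = nat \<lfloor>s / d\<rfloor>"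
  have a: "t \<le> real k * d \<longleftrightarrow> a \<le> k" for k
    using d by (simp add: a_def nat_le_iff ceiling_le_iff pos_divide_le_eq)
  have b: "real k * d \<le> s \<longleftrightarrow> k \<le> b" for k
    using d ts by (simp add: b_def le_nat_iff le_floor_iff pos_le_divide_eq)
  have ta: "t \<le> real a * d" using a by blast
  have bs: "real b * d \<le> s" using b by blast
  have sb: "s < real (Suc b) * d" using b[of "Suc b"] by simp
  have at: "real a * d < t + d"
  proof (cases a)
    case 0
    then show ?thesis using ts d by simp
  next
    case (Suc a')
    with a[of a'] show ?thesis by (simp add: algebra_simps)
  qed
  have "b \<le> N"
  proof (rule ccontr)
    assume "\<not> b \<le> N"
    then have "real N * d < real b * d" using d by simp
    with N bs show False by simp
  qed
  then have "{..<N} \<inter> {k. a \<le> k \<and> Suc k \<le> b} = {a..<b}" by auto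
  then have sum: "(\<Sum>k<N. if t \<le> real k * d \<and> real (Suc k) * d \<le> s
      then f (real (Suc k) * d) - f (real k * d) else 0) =
      (\<Sum>k\<in>{a..<b}. f (real (Suc k) * d) - f (real k * d))"
    unfolding a b by (subst sum.If_cases) auto
  show ?thesis
  proof (cases "a \<le> b")
    case True
    then have ab: "real a * d \<le> real b * d" using d by simp
    have "cmod (f s - f (real b * d)) \<le> M * (s - real b * d)"
      by (rule lip) (use ta ab bs in auto)
    also have "\<dots> \<le> M * d" using sb M by (intro mult_left_mono) (auto simp: algebra_simps)
    finally have 1: "cmod (f s - f (real b * d)) \<le> M * d" .
    have "cmod (f (real a * d) - f t) \<le> M * (real a * d - t)"
      by (rule lip) (use ta ab bs in auto)
    also have "\<dots> \<le> M * d" using at M by (intro mult_left_mono) auto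
    finally have 2: "cmod (f (real a * d) - f t) \<le> M * d" .
    have "(\<Sum>k\<in>{a..<b}. f (real (Suc k) * d) - f (real k * d)) = f (real b * d) - f (real a * d)"
      by (rule sum_Suc_diff'[OF True])
    then have "f s - f t - (\<Sum>k\<in>{a..<b}. f (real (Suc k) * d) - f (real k * d))
        = (f s - f (real b * d)) + (f (real a * d) - f t)" by simp
    then show ?thesis
      using norm_triangle_mono[OF 1 2] by (simp only: sum)
  next
    \<comment> \<open>No node lies between \<open>t\<close> and \<open>s\<close>: the sum is empty
      and the whole increment is an error over a length at most \<open>d\<close>.\<close>
    case False
    then have "real (Suc b) * d \<le> real a * d" using d by (intro mult_right_mono) auto
    then have "s - t \<le> d" using sb at by simp
    have "cmod (f s - f t) \<le> M * (s - t)" by (rule lip) (use ts in auto)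
    also have "\<dots> \<le> M * d" using \<open>s - t \<le> d\<close> M by (intro mult_left_mono)
    also have "\<dots> \<le> 2 * M * d" using M d by simp
    finally show ?thesis unfolding sum using False by simp
  qed
qed

section \<open>The estimate for the multiplied kernel\<close>

theorem proposition5p1:
  fixes T C\<^sub>K :: real and I :: "real set" and K chi :: "real \<times> real \<Rightarrow> complex"
  assumes "T > 0"
    and I: "I = {0<..<T}"
    and "K \<in> L2 (I \<times> I)"
    and "\<And>u v. u \<in> L2 I \<Longrightarrow> v \<in> L2 I \<Longrightarrow>
      cmod (\<integral>(s, t). K (s, t) * u s * cnj (v t) \<partial>lebesgue_on (I \<times> I))
        \<le> C\<^sub>K * L2_norm I u * L2_norm I v"
    and "chi \<in> W1inf (I \<times> I)"
    and chi_continuous_representative: "continuous_on (I \<times> I) chi"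
    and "\<And>s. s \<in> I \<Longrightarrow> chi (s, s) = 0"
  shows "\<forall>u \<in> L2 I. \<forall>v \<in> L2 I.
      cmod (\<integral>(s, t). chi (s, t) * K (s, t) * u s * cnj (v t) \<partial>lebesgue_on (I \<times> I))
        \<le> T * C\<^sub>K * (Linf_norm (I \<times> I) (weak_partial (I \<times> I) (1, 0) chi)
                      + Linf_norm (I \<times> I) (weak_partial (I \<times> I) (0, 1) chi))
            * L2_norm I u * L2_norm I v"
proof (intro ballI)
  fix u v assume u: "u \<in> L2 I" and v: "v \<in> L2 I"
  note T = assms(1) and K = assms(3) and W = assms(5) and diag = assms(7)
  let ?S = "I \<times> I"
  let ?L = "lebesgue_on ?S"
  define M1 where "M1 = Linf_norm ?S (weak_partial ?S (1, 0) chi)"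
  define M2 where "M2 = Linf_norm ?S (weak_partial ?S (0, 1) chi)"
  have M: "0 \<le> M1" "0 \<le> M2" by (simp_all add: M1_def M2_def Linf_norm_nonneg)
  have I': "I \<in> sets lebesgue" and S: "open ?S" "convex ?S"
    by (auto simp: I intro: open_Times convex_Times)
  then have S': "?S \<in> sets lebesgue" by auto
  have basis: "(1, 0) \<in> (Basis :: (real \<times> real) set)" "(0, 1) \<in> (Basis :: (real \<times> real) set)"
    by (auto simp: Basis_prod_def)
  have bound: "cmod (\<integral>x. K x * u (fst x) * cnj (v (snd x)) \<partial>?L) \<le> C\<^sub>K * L2_norm I u * L2_norm I v"
    if "u \<in> L2 I" "v \<in> L2 I" for u v
    using assms(4)[OF that] by (simp add: case_prod_unfold)
  have C: "0 \<le> C\<^sub>K"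
    by (rule bilinear_bound_nonneg[OF T]) (use bound order.trans[OF norm_ge_zero] I in blast)
  have lip1: "cmod (chi (y, t) - chi (x, t)) \<le> M1 * (y - x)"
    if "t \<in> I" "x \<in> I" "y \<in> I" "x \<le> y" for x y t
    using W1inf_increment_bound[OF S W chi_continuous_representative basis(1), of "y - x" "(x, t)"] that
    by (simp add: M1_def)
  have lip2: "cmod (chi (s, y) - chi (s, x)) \<le> M2 * (y - x)"
    if "s \<in> I" "x \<in> I" "y \<in> I" "x \<le> y" for x y s
    using W1inf_increment_bound[OF S W chi_continuous_representative basis(2), of "y - x" "(s, x)"] that
    by (simp add: M2_def)
  define G where "G x = K x * u (fst x) * cnj (v (snd x))" for x
  have G: "integrable ?L G"
    unfolding G_def by (rule integrable_L2_kernel[OF I' I' K u v])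
  define J where "J = (\<integral>x. cmod (G x) \<partial>?L)"
  have chi_meas: "chi \<in> borel_measurable ?L"
    by (rule continuous_imp_measurable_on_sets_lebesgue[OF chi_continuous_representative S'])
  \<comment> \<open>Integrability needs a pointwise bound on \<open>chi\<close>, which comes from
    its zero on the diagonal and the Lipschitz bounds.\<close>
  have chiG: "integrable ?L (\<lambda>x. chi x * G x)"
  proof (rule Bochner_Integration.integrable_bound)
    show "integrable ?L (\<lambda>x. (M1 + M2) * T * cmod (G x))" using G by auto
    have [measurable]: "G \<in> borel_measurable ?L" using G by auto
    note [measurable] = chi_meas
    show "(\<lambda>x. chi x * G x) \<in> borel_measurable ?L" by measurable
    have "cmod (chi (s, t)) \<le> (M1 + M2) * T" if "s \<in> I" "t \<in> I" for s t
    proof (cases "t \<le> s")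
      case True
      then have "cmod (chi (s, t)) \<le> M1 * (s - t)"
        using lip1[of t t s] that diag[of t] by simp
      also have "\<dots> \<le> (M1 + M2) * T" using M that True by (intro mult_mono) (auto simp: I)
      finally show ?thesis .
    next
      case False
      then have "cmod (chi (s, t)) \<le> M2 * (t - s)"
        using lip2[of s s t] that diag[of s] by simp
      also have "\<dots> \<le> (M1 + M2) * T" using M that False by (intro mult_mono) (auto simp: I)
      finally show ?thesis .
    qed
    then have "cmod (chi x * G x) \<le> (M1 + M2) * T * cmod (G x)" if "x \<in> ?S" for x
      using that by (auto simp: norm_mult mult_right_mono)
    then show "AE x in ?L. cmod (chi x * G x) \<le> norm ((M1 + M2) * T * cmod (G x))"
      by (intro AE_I2) (fastforce intro: order.trans[OF _ abs_ge_self])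
  qed
  let ?U = "C\<^sub>K * L2_norm I u * L2_norm I v"
  have step: "cmod (\<integral>x. chi x * G x \<partial>?L) \<le> T * (M1 + M2) * ?U + 2 * (M1 + M2) * T * J / real N"
    if "0 < N" for N
  proof -
    define d where "d = T / real N"
    have d: "0 < d" "real N * d = T" using T that by (auto simp: d_def)
    have grid: "real k * d \<in> I" if "0 < k" "k < N" for k
    proof -
      have "real k * d < real N * d" using that d by (intro mult_strict_right_mono) auto
      with that d show ?thesis by (simp add: I)
    qed
    \<comment> \<open>\<open>up k r\<close> says that cell \<open>k\<close> lies below
      \<open>r\<close>. Its product with \<open>low1\<close> at \<open>t\<close> keeps the increment
      of \<open>chi\<close> over cell \<open>k\<close> exactly when that cell lies between
      \<open>t\<close> and \<open>s\<close>, the discrete form of t < \<tau> < s.\<close>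
    define up where "up k r = complex_of_real (indicator {real (Suc k) * d..} r)" for k r
    \<comment> \<open>the guards only exclude \<open>k\<close> with a node outside \<open>I\<close>, where \<open>chi\<close> is not controlled\<close>
    define low1 where "low1 k t = (if 0 < k \<and> Suc k < N then complex_of_real (indicator {..real k * d} t) *
        (chi (real (Suc k) * d, t) - chi (real k * d, t)) else 0)" for k t
    define low2 where "low2 k s = (if 0 < k \<and> Suc k < N then complex_of_real (indicator {..real k * d} s) *
        (chi (s, real (Suc k) * d) - chi (s, real k * d)) else 0)" for k s
    have ind_meas: "(\<lambda>r. complex_of_real (indicator X r)) \<in> borel_measurable (lebesgue_on I)"
      if "X \<in> sets borel" for X
      by (intro measurable_restrict_space1 measurable_completion) (use that in auto)
    have up_meas: "up k \<in> borel_measurable (lebesgue_on I)" for k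
      unfolding up_def by (rule ind_meas) simp
    have up_le: "cmod (up k r) \<le> 1" for k r by (simp add: up_def indicator_def)
    have low1_meas: "low1 k \<in> borel_measurable (lebesgue_on I)" for k
    proof (cases "0 < k \<and> Suc k < N")
      case True
      have "continuous_on I (\<lambda>t. chi (x, t))" if "x \<in> I" for x
        by (rule continuous_on_compose2[OF chi_continuous_representative, of I "\<lambda>t. (x, t)"])
           (use that in \<open>auto intro!: continuous_intros\<close>)
      then have "(\<lambda>t. chi (x, t)) \<in> borel_measurable (lebesgue_on I)" if "x \<in> I" for x
        using that I' by (intro continuous_imp_measurable_on_sets_lebesgue)
      with True show ?thesis unfolding low1_def
        by (simp del: of_nat_Suc) (intro borel_measurable_times borel_measurable_diff ind_meas; simp add: grid del: of_nat_Suc)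
    next
      case False
      then show ?thesis unfolding low1_def by (simp only: if_False) simp
    qed
    have low2_meas: "low2 k \<in> borel_measurable (lebesgue_on I)" for k
    proof (cases "0 < k \<and> Suc k < N")
      case True
      have "continuous_on I (\<lambda>s. chi (s, x))" if "x \<in> I" for x
        by (rule continuous_on_compose2[OF chi_continuous_representative, of I "\<lambda>s. (s, x)"])
           (use that in \<open>auto intro!: continuous_intros\<close>)
      then have "(\<lambda>s. chi (s, x)) \<in> borel_measurable (lebesgue_on I)" if "x \<in> I" for x
        using that I' by (intro continuous_imp_measurable_on_sets_lebesgue)
      with True show ?thesis unfolding low2_def
        by (simp del: of_nat_Suc) (intro borel_measurable_times borel_measurable_diff ind_meas; simp add: grid del: of_nat_Suc)
    next
      case False
      then show ?thesis unfolding low2_def by (simp only: if_False) simp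
    qed
    have low1_le: "cmod (low1 k t) \<le> M1 * d" if "t \<in> I" for k t
    proof (cases "0 < k \<and> Suc k < N")
      case True
      with lip1[OF that grid[of k] grid[of "Suc k"]] d M show ?thesis
        by (auto simp: low1_def norm_mult indicator_def algebra_simps)
    qed (use M d in \<open>auto simp: low1_def\<close>)
    have low2_le: "cmod (low2 k s) \<le> M2 * d" if "s \<in> I" for k s
    proof (cases "0 < k \<and> Suc k < N")
      case True
      with lip2[OF that grid[of k] grid[of "Suc k"]] d M show ?thesis
        by (auto simp: low2_def norm_mult indicator_def algebra_simps)
    qed (use M d in \<open>auto simp: low2_def\<close>)
    define P1 where "P1 x = (\<Sum>k<N. up k (fst x) * low1 k (snd x))" for x
    define P2 where "P2 x = (\<Sum>k<N. low2 k (fst x) * up k (snd x))" for x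
    have Md: "0 \<le> M1 * d" "0 \<le> M2 * d" using M d by auto
    \<comment> \<open>The guard in \<open>low1\<close> drops out: \<open>t > 0\<close> forces
      \<open>k > 0\<close>, and \<open>s < T\<close> forces \<open>Suc k < N\<close>.\<close>
    have P1': "up k s * low1 k t = (if t \<le> real k * d \<and> real (Suc k) * d \<le> s
        then chi (real (Suc k) * d, t) - chi (real k * d, t) else 0)" if "s \<in> I" "t \<in> I" for s t k
    proof (cases "t \<le> real k * d \<and> real (Suc k) * d \<le> s")
      case True
      then have "0 < real k * d" "real (Suc k) * d < real N * d" using that d by (auto simp: I)
      then have "0 < k" "Suc k < N" using d by (auto simp: zero_less_mult_iff simp del: of_nat_Suc)
      with True show ?thesis by (simp add: up_def low1_def)
    qed (auto simp: up_def low1_def indicator_def)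
    have P2': "low2 k s * up k t = (if s \<le> real k * d \<and> real (Suc k) * d \<le> t
        then chi (s, real (Suc k) * d) - chi (s, real k * d) else 0)" if "s \<in> I" "t \<in> I" for s t k
    proof (cases "s \<le> real k * d \<and> real (Suc k) * d \<le> t")
      case True
      then have "0 < real k * d" "real (Suc k) * d < real N * d" using that d by (auto simp: I)
      then have "0 < k" "Suc k < N" using d by (auto simp: zero_less_mult_iff simp del: of_nat_Suc)
      with True show ?thesis by (simp add: up_def low2_def)
    qed (auto simp: up_def low2_def indicator_def)
    \<comment> \<open>Cells have positive length, so \<open>P2\<close> vanishes where
      \<open>t \<le> s\<close> and \<open>P1\<close> where \<open>s \<le> t\<close>.\<close>
    have empty: "\<not> (t \<le> real k * d \<and> real (Suc k) * d \<le> s)" if "s \<le> t" for s t k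
      using that d by (auto simp: algebra_simps)
    have approx: "cmod (chi x - (P1 x + P2 x)) \<le> 2 * (M1 + M2) * d" if "x \<in> ?S" for x
    proof -
      obtain s t where x: "x = (s, t)" and st: "s \<in> I" "t \<in> I" using \<open>x \<in> ?S\<close> by auto
      show ?thesis
      proof (cases "t \<le> s")
        case True
        have "P2 x = 0" unfolding P2_def x fst_conv snd_conv P2'[OF st] by (simp only: empty[OF True] if_False sum.neutral_const)
        moreover have "cmod (chi (s, t) - chi (t, t) - P1 x) \<le> 2 * M1 * d"
          unfolding P1_def x fst_conv snd_conv P1'[OF st]
          by (rule grid_telescoping[where f = "\<lambda>r. chi (r, t)"])
             (use d st True M in \<open>auto simp: I intro!: lip1[unfolded I]\<close>)
        moreover have "0 \<le> M2 * d" by (rule Md)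
        ultimately show ?thesis using diag[OF st(2)] by (simp add: x algebra_simps)
      next
        case False
        then have le: "s \<le> t" by simp
        have "P1 x = 0" unfolding P1_def x fst_conv snd_conv P1'[OF st] by (simp only: empty[OF le] if_False sum.neutral_const)
        moreover have "cmod (chi (s, t) - chi (s, s) - P2 x) \<le> 2 * M2 * d"
          unfolding P2_def x fst_conv snd_conv P2'[OF st]
          by (rule grid_telescoping[where f = "\<lambda>r. chi (s, r)"])
             (use d st le M in \<open>auto simp: I intro!: lip2[unfolded I]\<close>)
        moreover have "0 \<le> M1 * d" by (rule Md)
        ultimately show ?thesis using diag[OF st(1)] by (simp add: x algebra_simps)
      qed
    qed
    have P1: "integrable ?L (\<lambda>x. P1 x * G x)"
      unfolding P1_def P2_def G_def
      by (rule bilinear_bound_separable_sum(1)[where C = "C\<^sub>K" and c = "1" and d = "M1 * d"];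
          (assumption | rule I' K C bound u v up_meas up_le low1_meas low1_le low2_meas low2_le Md zero_le_one))
    \<comment> \<open>There are \<open>N\<close> terms, each costing \<open>M1 * d\<close>, and
      \<open>real N * d = T\<close>; this is the source of the factor \<open>T\<close>.\<close>
    have P1_le: "cmod (\<integral>x. P1 x * G x \<partial>?L) \<le> real (card {..<N}) * (1 * (M1 * d) * ?U)"
      unfolding P1_def P2_def G_def
      by (rule bilinear_bound_separable_sum(2)[where C = "C\<^sub>K" and c = "1" and d = "M1 * d"];
          (assumption | rule I' K C bound u v up_meas up_le low1_meas low1_le low2_meas low2_le Md zero_le_one))
    have P2: "integrable ?L (\<lambda>x. P2 x * G x)"
      unfolding P1_def P2_def G_def
      by (rule bilinear_bound_separable_sum(1)[where C = "C\<^sub>K" and c = "M2 * d" and d = "1"];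
          (assumption | rule I' K C bound u v up_meas up_le low1_meas low1_le low2_meas low2_le Md zero_le_one))
    have P2_le: "cmod (\<integral>x. P2 x * G x \<partial>?L) \<le> real (card {..<N}) * ((M2 * d) * 1 * ?U)"
      unfolding P1_def P2_def G_def
      by (rule bilinear_bound_separable_sum(2)[where C = "C\<^sub>K" and c = "M2 * d" and d = "1"];
          (assumption | rule I' K C bound u v up_meas up_le low1_meas low1_le low2_meas low2_le Md zero_le_one))
    have int_R: "integrable ?L (\<lambda>x. (chi x - (P1 x + P2 x)) * G x)"
      using chiG P1 P2 by (simp add: algebra_simps)
    \<comment> \<open>The remainder is measured by the L1 norm \<open>J\<close> of \<open>G\<close>,
      for which \<open>C\<^sub>K\<close> gives no bound; finiteness is enough, since the factor
      \<open>d\<close> tends to 0 with 1/N.\<close>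
    have "cmod (\<integral>x. (chi x - (P1 x + P2 x)) * G x \<partial>?L) \<le> (\<integral>x. 2 * (M1 + M2) * d * cmod (G x) \<partial>?L)"
    proof (rule order.trans[OF integral_norm_bound integral_mono])
      show "integrable ?L (\<lambda>x. norm ((chi x - (P1 x + P2 x)) * G x))"
        using int_R by (rule integrable_norm)
      show "integrable ?L (\<lambda>x. 2 * (M1 + M2) * d * cmod (G x))" using G by auto
      show "norm ((chi x - (P1 x + P2 x)) * G x) \<le> 2 * (M1 + M2) * d * cmod (G x)" if "x \<in> space ?L" for x
        unfolding norm_mult using approx[of x] that by (intro mult_right_mono) auto
    qed
    also have "\<dots> = 2 * (M1 + M2) * d * J" by (simp add: J_def)
    finally have R_le: "cmod (\<integral>x. (chi x - (P1 x + P2 x)) * G x \<partial>?L) \<le> 2 * (M1 + M2) * d * J" .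
    have "(\<lambda>x. chi x * G x) = (\<lambda>x. (P1 x * G x + P2 x * G x) + (chi x - (P1 x + P2 x)) * G x)"
      by (simp add: fun_eq_iff algebra_simps)
    then have "(\<integral>x. chi x * G x \<partial>?L) = (\<integral>x. (P1 x * G x + P2 x * G x) + (chi x - (P1 x + P2 x)) * G x \<partial>?L)"
      by simp
    also have "\<dots> = (\<integral>x. P1 x * G x \<partial>?L) + (\<integral>x. P2 x * G x \<partial>?L) + (\<integral>x. (chi x - (P1 x + P2 x)) * G x \<partial>?L)"
      by (simp only: Bochner_Integration.integral_add P1 P2 int_R Bochner_Integration.integrable_add)
    also have "cmod \<dots> \<le> real (card {..<N}) * (1 * (M1 * d) * ?U) + real (card {..<N}) * (M2 * d * 1 * ?U)
        + 2 * (M1 + M2) * d * J"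
      by (intro norm_triangle_mono P1_le P2_le R_le)
    also have "\<dots> = (real N * d) * (M1 + M2) * ?U + 2 * (M1 + M2) * d * J"
      by (simp add: algebra_simps)
    also have "\<dots> = T * (M1 + M2) * ?U + 2 * (M1 + M2) * T * J / real N"
      unfolding d(2) by (simp add: d_def)
    finally show ?thesis .
  qed
  have "(\<lambda>N. T * (M1 + M2) * ?U + 2 * (M1 + M2) * T * J / real N) \<longlonglongrightarrow> T * (M1 + M2) * ?U + 0"
    by (intro tendsto_add tendsto_const lim_const_over_n)
  moreover have "eventually (\<lambda>N. cmod (\<integral>x. chi x * G x \<partial>?L)
      \<le> T * (M1 + M2) * ?U + 2 * (M1 + M2) * T * J / real N) sequentially"
    using eventually_gt_at_top[of 0] by (rule eventually_mono) (rule step)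
  ultimately have "cmod (\<integral>x. chi x * G x \<partial>?L) \<le> T * (M1 + M2) * ?U + 0"
    by (rule tendsto_lowerbound) simp
  moreover have "(\<integral>(s, t). chi (s, t) * K (s, t) * u s * cnj (v t) \<partial>?L) = (\<integral>x. chi x * G x \<partial>?L)"
    by (simp add: G_def case_prod_unfold mult.assoc)
  ultimately show "cmod (\<integral>(s, t). chi (s, t) * K (s, t) * u s * cnj (v t) \<partial>?L)
        \<le> T * C\<^sub>K * (Linf_norm ?S (weak_partial ?S (1, 0) chi) + Linf_norm ?S (weak_partial ?S (0, 1) chi))
            * L2_norm I u * L2_norm I v"
    by (simp add: M1_def M2_def mult_ac)
qed

end
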